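(* Let $g=\begin{bmatrix} R & b \\ 0 & 1 \end{bmatrix}\in SE(3)$ be the pose of a rigid body with $\dot g=g\xi^\vee$, let $\hat g=\begin{bmatrix} \hat R & \hat b \\ 0 & 1 \end{bmatrix}\in SE(3)$ and $\hat\xi$ be estimates with $\dot{\hat g}=\hat g\hat\xi^\vee$, let $\mathsf h=g\hat g^{-1}=\begin{bmatrix} Q & x \\ 0 & 1 \end{bmatrix}$ and $\varphi=[\omega^T, \upsilon^T]^T=\mathrm{Ad}_{\hat g}(\xi^m-\hat\xi)$. The nonlinear variational estimator for pose and velocities, obtained by applying the Lagrange-d'Alembert principle to the Lagrangian $$\mathcal L=\tfrac12\varphi^T\mathbb J\varphi-\Phi\Big(\tfrac12\langle D-\hat RL^m,(D-\hat RL^m)W\rangle\Big)-\tfrac12\kappa\|\bar p-\hat R\bar a^m-\hat b\|^2$$ with a dissipation term $\mathbb D\varphi$ linear in the velocities estimation error (principle and variations as in the context), is given by $$\begin{cases} \mathbb J\dot\varphi=\mathrm{ad}^*_\varphi\,\mathbb J\varphi-Z(\hat g,L^m,D,\bar a^m,\bar p)-\mathbb D\varphi, \\ \hat\xi=\xi^m-\mathrm{Ad}_{\hat g^{-1}}\varphi, \\ \dot{\hat g}=\hat g\,\hat\xi^\vee, \end{cases}$$ where $$Z(\hat g,L^m,D,\bar a^m,\bar p)=\begin{bmatrix} \Phi'\big(\mathcal U^0_r(\hat g,L^m,D)\big)S_\Gamma(\hat R)+\kappa\,\bar p^\times y \\ \kappa y \end{bmatrix},$$ $\mathcal U^0_r(\hat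 g,L^m,D)=\frac12\langle D-\hat RL^m,(D-\hat RL^m)W\rangle$, $y=\bar p-\hat R\bar a^m-\hat b$, $\Gamma=DW(L^m)^T$ and $$S_\Gamma(\hat R)=\mathrm{vex}\big(\Gamma\hat R^T-\hat R\Gamma^T\big)=\mathrm{vex}\big(DW(L^m)^T\hat R^T-\hat RL^mWD^T\big).$$
   Context: $a^\times$ is the skew-symmetric matrix with $a^\times c=a\times c$; $\mathrm{vex}:\mathfrak{so}(3)\to\mathbb R^3$ is the inverse of $a\mapsto a^\times$; $\langle A_1,A_2\rangle=\mathrm{trace}(A_1^TA_2)$. For $\zeta=[w^T, v^T]^T\in\mathbb R^6$: $\zeta^\vee=\begin{bmatrix} w^\times & v \\ 0 & 0 \end{bmatrix}$, $\mathrm{ad}_\zeta=\begin{bmatrix} w^\times & 0 \\ {v}^\times & w^\times \end{bmatrix}$, $\mathrm{ad}^*_\zeta=(\mathrm{ad}_\zeta)^T$; $\mathrm{Ad}_g=\begin{bmatrix} R & 0 \\ {b}^\times R & R \end{bmatrix}$. Measurements: $D\in\mathbb R^{3\times n}$ (rank 3) has as columns vectors known in the inertial frame (relative positions of observed beacons and inertial directions; the cross product is added as a third column if there are only two), $L^m\in\mathbb R^{3\times n}$ is the matrix of the corresponding vectors measured in the body frame ($L^m=L=R^TD$ without noise); $\bar p\in\mathbb R^3$ is the mean of the inertial positions of observed beacons and $\bar a^m$ the mean of their measured body-frame positions ($\bar a^m=R^T(\bar p-b)$ without noise); $\xi^m$ is the measured velocity ($\xi^m=\xi$ without noise). $W\in\mathbb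 R^{n\times n}$ is symmetric positive definite, $\kappa>0$, $\mathbb J,\mathbb D\in\mathbb R^{6\times6}$ are positive definite ($\mathbb J$ symmetric), $\Phi:[0,\infty)\to[0,\infty)$ is $C^2$ with $\Phi(0)=0$ and $\Phi'>0$ on $[0,\infty)$. Lagrange-d'Alembert principle used: without noise the Lagrangian becomes the function $\mathcal L(\mathsf h,D,\bar p,\varphi)=\frac12\varphi^T\mathbb J\varphi-\Phi(\langle I-Q,K\rangle)-\frac12\kappa y^Ty$ with $K=DWD^T$, $y=Q^Tx+(I-Q^T)\bar p$, and $\dot{\mathsf h}=\mathsf h\varphi^\vee$. One requires $\delta_{\mathsf h,\varphi}\int_{t_0}^T\mathcal L\,dt=\int_{t_0}^T\eta^T\mathbb D\varphi\,dt$ for all reduced variations $\delta\mathsf h=\mathsf h\eta^\vee$, $\delta\varphi=\dot\eta+\mathrm{ad}_\varphi\eta$ with $\eta(t_0)=\eta(T)=0$ ($D,W,\bar p$ not varied). The resulting equation is then expressed through the measurements by substituting $Q^TD=\hat RL^m$ and $y=\bar p-\hat R\bar a^m-\hat b$. *)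

theory Defs
  imports "HOL-Analysis.Analysis"
begin

text \<open>Block vectors and block matrices are indexed by sum types: the space of twists
  \<open>[w, v]\<close> is indexed by \<open>3 + 3\<close> (six indices, angular part first), and homogeneous
  \<open>4 \<times> 4\<close> matrices are indexed by \<open>3 + 1\<close>.\<close>

type_synonym twist = "real^(3 + 3)"
type_synonym hmat = "real^(3 + 1)^(3 + 1)"

definition block :: "'a^'m^'n \<Rightarrow> 'a^'q^'n \<Rightarrow> 'a^'m^'p \<Rightarrow> 'a^'q^'p \<Rightarrow> 'a^('m + 'q)^('n + 'p)" where
  "block A B C E = (\<chi> i j. case i of
      Inl k \<Rightarrow> (case j of Inl l \<Rightarrow> A $ k $ l | Inr l \<Rightarrow> B $ k $ l)
    | Inr k \<Rightarrow> (case j of Inl l \<Rightarrow> C $ k $ l | Inr l \<Rightarrow> E $ k $ l))"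

definition stack :: "'a^'n \<Rightarrow> 'a^'p \<Rightarrow> 'a^('n + 'p)" where
  "stack w v = (\<chi> i. case i of Inl k \<Rightarrow> w $ k | Inr k \<Rightarrow> v $ k)"

definition ang :: "twist \<Rightarrow> real^3" where
  "ang \<zeta> = (\<chi> k. \<zeta> $ Inl k)"

definition lin :: "twist \<Rightarrow> real^3" where
  "lin \<zeta> = (\<chi> k. \<zeta> $ Inr k)"

definition cross_mat :: "real^3 \<Rightarrow> real^3^3" where
  "cross_mat a = matrix (cross3 a)"

text \<open>Only meaningful on skew-symmetric matrices, the range of the injective map
  \<^const>\<open>cross_mat\<close>.\<close>

definition vex :: "real^3^3 \<Rightarrow> real^3" where
  "vex = inv cross_mat"

definition mat_inner :: "real^'n^'m \<Rightarrow> real^'n^'m \<Rightarrow> real" where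
  "mat_inner A B = trace (transpose A ** B)"

definition pos_def :: "real^'n^'n \<Rightarrow> bool" where
  "pos_def A \<longleftrightarrow> (\<forall>x. x \<noteq> 0 \<longrightarrow> x \<bullet> (A *v x) > 0)"

definition pose :: "real^3^3 \<Rightarrow> real^3 \<Rightarrow> hmat" where
  "pose R b = block R (columnvector b) 0 (mat 1)"

definition SE3 :: "hmat set" where
  "SE3 = {pose R b | R b. rotation_matrix R}"

definition rot :: "hmat \<Rightarrow> real^3^3" where
  "rot h = (\<chi> i j. h $ Inl i $ Inl j)"

definition trans_part :: "hmat \<Rightarrow> real^3" where
  "trans_part h = (\<chi> i. h $ Inl i $ Inr 1)"

definition hat :: "twist \<Rightarrow> hmat" where
  "hat \<zeta> = block (cross_mat (ang \<zeta>)) (columnvector (lin \<zeta>)) 0 0"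

definition ad :: "twist \<Rightarrow> real^(3 + 3)^(3 + 3)" where
  "ad \<zeta> = block (cross_mat (ang \<zeta>)) 0 (cross_mat (lin \<zeta>)) (cross_mat (ang \<zeta>))"

definition ad_star :: "twist \<Rightarrow> real^(3 + 3)^(3 + 3)" where
  "ad_star \<zeta> = transpose (ad \<zeta>)"

definition Ad :: "hmat \<Rightarrow> real^(3 + 3)^(3 + 3)" where
  "Ad g = block (rot g) 0 (cross_mat (trans_part g) ** rot g) (rot g)"

definition U0r :: "real^'n^'n \<Rightarrow> hmat \<Rightarrow> real^'n^3 \<Rightarrow> real^'n^3 \<Rightarrow> real" where
  "U0r W gh Lm D = 1 / 2 * mat_inner (D - rot gh ** Lm) ((D - rot gh ** Lm) ** W)"

definition pos_err :: "hmat \<Rightarrow> real^3 \<Rightarrow> real^3 \<Rightarrow> real^3" where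
  "pos_err gh am p = p - rot gh *v am - trans_part gh"

definition S_Gamma :: "real^3^3 \<Rightarrow> real^3^3 \<Rightarrow> real^3" where
  "S_Gamma \<Gamma> Rh = vex (\<Gamma> ** transpose Rh - Rh ** transpose \<Gamma>)"

text \<open>\<open>dPhi\<close> is the derivative of \<open>\<Phi>\<close>.\<close>

definition Z :: "(real \<Rightarrow> real) \<Rightarrow> real \<Rightarrow> real^'n^'n \<Rightarrow>
    hmat \<Rightarrow> real^'n^3 \<Rightarrow> real^'n^3 \<Rightarrow> real^3 \<Rightarrow> real^3 \<Rightarrow> twist" where
  "Z dPhi \<kappa> W gh Lm D am p =
     (let y = pos_err gh am p; \<Gamma> = D ** W ** transpose Lm
      in stack (dPhi (U0r W gh Lm D) *\<^sub>R S_Gamma \<Gamma> (rot gh) + \<kappa> *\<^sub>R (cross_mat p *v y))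
               (\<kappa> *\<^sub>R y))"

definition measured_lagrangian :: "real^(3 + 3)^(3 + 3) \<Rightarrow> (real \<Rightarrow> real) \<Rightarrow> real \<Rightarrow> real^'n^'n \<Rightarrow>
    hmat \<Rightarrow> real^'n^3 \<Rightarrow> real^'n^3 \<Rightarrow> real^3 \<Rightarrow> real^3 \<Rightarrow> twist \<Rightarrow> real" where
  "measured_lagrangian J \<Phi> \<kappa> W gh Lm D am p \<phi> =
     1 / 2 * (\<phi> \<bullet> (J *v \<phi>))
     - \<Phi> (1 / 2 * mat_inner (D - rot gh ** Lm) ((D - rot gh ** Lm) ** W))
     - 1 / 2 * \<kappa> * (norm (p - rot gh *v am - trans_part gh))\<^sup>2"

definition reduced_lagrangian :: "real^(3 + 3)^(3 + 3) \<Rightarrow> (real \<Rightarrow> real) \<Rightarrow> real \<Rightarrow> real^'n^'n \<Rightarrow>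
    hmat \<Rightarrow> real^'n^3 \<Rightarrow> real^3 \<Rightarrow> twist \<Rightarrow> real" where
  "reduced_lagrangian J \<Phi> \<kappa> W h D p \<phi> =
     (let Q = rot h; x = trans_part h; K = D ** W ** transpose D;
          y = transpose Q *v x + (mat 1 - transpose Q) *v p
      in 1 / 2 * (\<phi> \<bullet> (J *v \<phi>)) - \<Phi> (mat_inner (mat 1 - Q) K) - 1 / 2 * \<kappa> * (y \<bullet> y))"

text \<open>A deformation \<open>(H \<epsilon>, P \<epsilon>)\<close> of the curves \<open>(h, \<phi>)\<close> on \<open>[t0, T]\<close>, staying in \<open>SE(3)\<close>, of class
  \<open>C\<^sup>1\<close> in the parameter \<open>\<epsilon>\<close> (jointly continuous in \<open>\<epsilon>\<close> and time), whose first-order part at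
  \<open>\<epsilon> = 0\<close> is the reduced variation \<open>\<delta>h = h \<eta>\<^sup>\<or>\<close>, \<open>\<delta>\<phi> = \<eta>' + ad\<^sub>\<phi> \<eta>\<close>; here \<open>d\<eta>\<close> is the time
  derivative of \<open>\<eta>\<close>.\<close>

definition realizes_variation :: "real \<Rightarrow> real \<Rightarrow> (real \<Rightarrow> hmat) \<Rightarrow> (real \<Rightarrow> twist) \<Rightarrow>
    (real \<Rightarrow> twist) \<Rightarrow> (real \<Rightarrow> twist) \<Rightarrow>
    (real \<Rightarrow> real \<Rightarrow> hmat) \<Rightarrow> (real \<Rightarrow> real \<Rightarrow> twist) \<Rightarrow> bool" where
  "realizes_variation t0 T h \<phi> \<eta> d\<eta> H P \<longleftrightarrow>
     (\<exists>e dH dP. e > 0 \<and>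
        (\<forall>\<epsilon>\<in>{-e<..<e}. \<forall>t\<in>{t0..T}. H \<epsilon> t \<in> SE3
           \<and> ((\<lambda>s. H s t) has_vector_derivative dH \<epsilon> t) (at \<epsilon>)
           \<and> ((\<lambda>s. P s t) has_vector_derivative dP \<epsilon> t) (at \<epsilon>)) \<and>
        continuous_on ({-e<..<e} \<times> {t0..T}) (\<lambda>(\<epsilon>, t). H \<epsilon> t) \<and>
        continuous_on ({-e<..<e} \<times> {t0..T}) (\<lambda>(\<epsilon>, t). P \<epsilon> t) \<and>
        continuous_on ({-e<..<e} \<times> {t0..T}) (\<lambda>(\<epsilon>, t). dH \<epsilon> t) \<and>
        continuous_on ({-e<..<e} \<times> {t0..T}) (\<lambda>(\<epsilon>, t). dP \<epsilon> t) \<and>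
        (\<forall>t\<in>{t0..T}. H 0 t = h t \<and> P 0 t = \<phi> t
           \<and> dH 0 t = h t ** hat (\<eta> t)
           \<and> dP 0 t = d\<eta> t + ad (\<phi> t) *v \<eta> t))"

text \<open>\<open>lag t h \<phi>\<close> is the Lagrangian at time \<open>t\<close>; everything it depends on besides \<open>h\<close> and \<open>\<phi>\<close>
  is a prescribed function of time and is not varied.\<close>

definition lagrange_dAlembert :: "real \<Rightarrow> real \<Rightarrow> (real \<Rightarrow> hmat \<Rightarrow> twist \<Rightarrow> real) \<Rightarrow>
    real^(3 + 3)^(3 + 3) \<Rightarrow> (real \<Rightarrow> hmat) \<Rightarrow> (real \<Rightarrow> twist) \<Rightarrow> bool" where
  "lagrange_dAlembert t0 T lag Dm h \<phi> \<longleftrightarrow>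
     (\<forall>\<eta> d\<eta> H P.
        (\<forall>t\<in>{t0..T}. (\<eta> has_vector_derivative d\<eta> t) (at t within {t0..T})) \<and>
        continuous_on {t0..T} d\<eta> \<and> \<eta> t0 = 0 \<and> \<eta> T = 0 \<and>
        realizes_variation t0 T h \<phi> \<eta> d\<eta> H P \<longrightarrow>
        ((\<lambda>\<epsilon>. integral {t0..T} (\<lambda>t. lag t (H \<epsilon> t) (P \<epsilon> t))) has_real_derivative
           integral {t0..T} (\<lambda>t. \<eta> t \<bullet> (Dm *v \<phi> t))) (at 0))"

text \<open>\<open>d\<phi>\<close> is the time derivative of \<open>\<phi>\<close>; \<open>\<xi>m\<close>, \<open>Lm\<close>, \<open>am\<close> are the measured quantities.\<close>

definition variational_estimator :: "real \<Rightarrow> real \<Rightarrow> real^(3 + 3)^(3 + 3) \<Rightarrow> real^(3 + 3)^(3 + 3) \<Rightarrow>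
    (real \<Rightarrow> real) \<Rightarrow> real \<Rightarrow> real^'n^'n \<Rightarrow> (real \<Rightarrow> real^'n^3) \<Rightarrow> (real \<Rightarrow> real^3) \<Rightarrow>
    (real \<Rightarrow> twist) \<Rightarrow> (real \<Rightarrow> real^'n^3) \<Rightarrow> (real \<Rightarrow> real^3) \<Rightarrow>
    (real \<Rightarrow> hmat) \<Rightarrow> (real \<Rightarrow> twist) \<Rightarrow> (real \<Rightarrow> twist) \<Rightarrow> (real \<Rightarrow> twist) \<Rightarrow> bool" where
  "variational_estimator t0 T J Dm dPhi \<kappa> W D p \<xi>m Lm am gh \<xi>h \<phi> d\<phi> \<longleftrightarrow>
     (\<forall>t\<in>{t0..T}.
        J *v d\<phi> t = ad_star (\<phi> t) *v (J *v \<phi> t)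
                      - Z dPhi \<kappa> W (gh t) (Lm t) (D t) (am t) (p t) - Dm *v \<phi> t
      \<and> \<xi>h t = \<xi>m t - Ad (matrix_inv (gh t)) *v \<phi> t
      \<and> (gh has_vector_derivative gh t ** hat (\<xi>h t)) (at t within {t0..T}))"

end

theory Submission
  imports Defs
begin

text \<open>
  With the true pose and the measurements fixed, the estimate \<open>gh = h\<inverse> g\<close> is a function of the
  relative pose \<open>h\<close>, and \<open>\<delta>h = h \<eta>\<^sup>\<or>\<close> amounts to \<open>\<delta>gh = - \<eta>\<^sup>\<or> gh\<close>. Hence the potential varies by
  \<open>\<eta> \<bullet> Z\<close>: for the angular part \<open>\<langle>w\<^sup>\<times>, A\<rangle> = w \<bullet> vex (A - A\<^sup>T)\<close>, and in
  \<open>A = (D - Rh L\<^sup>m) W (Rh L\<^sup>m)\<^sup>T\<close> the term quadratic in \<open>L\<^sup>m\<close> is symmetric, so that only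
  \<open>\<Gamma> Rh\<^sup>T\<close> contributes; for the linear part \<open>\<delta>y = w \<times> (p - y) + v\<close>.
  Differentiating the action under the integral sign and integrating by parts, its derivative is
  \<open>\<integral> \<eta> \<bullet> (ad\<^sup>*\<^sub>\<phi> J\<phi> - J\<phi>' - Z)\<close>, and the equation of motion follows from the fundamental lemma of the
  calculus of variations. For this it is enough to vary along \<open>\<eta> = \<rho> \<zeta>\<close> with \<open>\<zeta>\<close> a standard basis
  vector; such a variation is realized by \<open>h\<close> times the rigid motion with the rotation by \<open>\<epsilon> \<rho>\<close>
  around the angular part of \<open>\<zeta>\<close> and the translation by \<open>\<epsilon> \<rho>\<close> times its linear part. Without
  noise, the reduced Lagrangian coincides with the measured one on \<open>SE(3)\<close>.
\<close>

section \<open>Block matrices and rigid motions\<close>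

lemma bounded_bilinear_matrix_mult:
  "bounded_bilinear ((**) :: real^'n^'m \<Rightarrow> real^'p^'n \<Rightarrow> real^'p^'m)"
  unfolding bilinear_conv_bounded_bilinear [symmetric] bilinear_def linear_iff
  by (simp add: vec_eq_iff matrix_matrix_mult_def algebra_simps sum.distrib sum_distrib_left)

lemma bounded_bilinear_matrix_vector_mult:
  "bounded_bilinear ((*v) :: real^'n^'m \<Rightarrow> real^'n \<Rightarrow> real^'m)"
  unfolding bilinear_conv_bounded_bilinear [symmetric] bilinear_def linear_iff
  by (simp add: vec_eq_iff matrix_vector_mult_def algebra_simps sum.distrib sum_distrib_left)

interpretation matmul: bounded_bilinear "(**) :: real^'n^'m \<Rightarrow> real^'p^'n \<Rightarrow> real^'p^'m"
  by (rule bounded_bilinear_matrix_mult)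

interpretation matvec: bounded_bilinear "(*v) :: real^'n^'m \<Rightarrow> real^'n \<Rightarrow> real^'m"
  by (rule bounded_bilinear_matrix_vector_mult)

lemma bounded_linear_transpose: "bounded_linear (transpose :: real^'n^'m \<Rightarrow> real^'m^'n)"
  by (simp add: linear_conv_bounded_linear [symmetric] linear_iff transpose_def vec_eq_iff)

lemma bounded_linear_rot: "bounded_linear rot"
  by (simp add: linear_conv_bounded_linear [symmetric] linear_iff rot_def vec_eq_iff)

lemma bounded_linear_trans_part: "bounded_linear trans_part"
  by (simp add: linear_conv_bounded_linear [symmetric] linear_iff trans_part_def vec_eq_iff)

section \<open>Block algebra over sum-type indices\<close>

lemma sum_UNIV_plus:
  "(\<Sum>i\<in>(UNIV :: ('m::finite + 'n::finite) set). f i) = (\<Sum>k\<in>UNIV. f (Inl k)) + (\<Sum>k\<in>UNIV. f (Inr k))"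
  by (subst UNIV_Plus_UNIV [symmetric], subst sum.Plus) (auto simp: o_def)

lemma all_UNIV_plus: "(\<forall>i::'m + 'n. P i) \<longleftrightarrow> (\<forall>k. P (Inl k)) \<and> (\<forall>k. P (Inr k))"
  by (metis sum.exhaust)

lemma block_mult:
  fixes A :: "real^'m^'n" and B :: "real^'q^'n" and C :: "real^'m^'p" and E :: "real^'q^'p"
    and A' :: "real^'r^'m" and B' :: "real^'s^'m" and C' :: "real^'r^'q" and E' :: "real^'s^'q"
  shows "block A B C E ** block A' B' C' E' =
    block (A ** A' + B ** C') (A ** B' + B ** E') (C ** A' + E ** C') (C ** B' + E ** E')"
  by (simp add: vec_eq_iff all_UNIV_plus block_def matrix_matrix_mult_def sum_UNIV_plus)

lemma block_eq_iff: "block A B C E = block A' B' C' E' \<longleftrightarrow> A = A' \<and> B = B' \<and> C = C' \<and> E = E'"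
  by (auto simp: vec_eq_iff all_UNIV_plus block_def)

lemma mat_1_block: "(mat 1 :: real^('m::finite+'n::finite)^('m+'n)) = block (mat 1) 0 0 (mat 1)"
  by (simp add: vec_eq_iff all_UNIV_plus block_def mat_def)

lemma inner_stack: "stack a b \<bullet> stack c e = a \<bullet> c + b \<bullet> (e :: real^'n)"
  by (simp add: inner_vec_def stack_def sum_UNIV_plus)

lemma stack_ang_lin [simp]: "stack (ang \<zeta>) (lin \<zeta>) = \<zeta>"
  by (simp add: vec_eq_iff all_UNIV_plus stack_def ang_def lin_def)

lemma columnvector_simps:
  "columnvector a + columnvector b = columnvector (a + b :: real^'n)"
  "columnvector (0 :: real^'n) = 0"
  "(A :: real^'n^'m) ** columnvector a = columnvector (A *v a)"
  by (auto simp: vec_eq_iff columnvector_def matrix_matrix_mult_def matrix_vector_mult_def)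

section \<open>Poses, their products and inverses\<close>

lemma rot_pose [simp]: "rot (pose R b) = R" and trans_part_pose [simp]: "trans_part (pose R b) = b"
  by (simp_all add: vec_eq_iff rot_def trans_part_def pose_def block_def columnvector_def)

lemma pose_mult: "pose R b ** pose R' b' = pose (R ** R') (R *v b' + b)"
  by (simp add: pose_def block_mult block_eq_iff columnvector_simps)

text \<open>The zero bottom row of \<open>hat\<close> annihilates the translation \<open>b\<close>,
  so only \<open>R\<close> acts on the two parts of the twist.\<close>

lemma rot_mult_hat: "rot (pose R b ** hat \<zeta>) = R ** cross_mat (ang \<zeta>)"
  and trans_part_mult_hat: "trans_part (pose R b ** hat \<zeta>) = R *v lin \<zeta>"
proof -
  have "pose R b ** hat \<zeta> = block (R ** cross_mat (ang \<zeta>)) (columnvector (R *v lin \<zeta>)) 0 0"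
    by (simp add: pose_def hat_def block_mult columnvector_simps)
  then show "rot (pose R b ** hat \<zeta>) = R ** cross_mat (ang \<zeta>)"
    and "trans_part (pose R b ** hat \<zeta>) = R *v lin \<zeta>"
    by (simp_all add: vec_eq_iff rot_def trans_part_def block_def columnvector_def)
qed

lemma rotation_matrix_mult:
  fixes A B :: "real^'n^'n"
  assumes "rotation_matrix A" "rotation_matrix B"
  shows "rotation_matrix (A ** B)"
  using assms orthogonal_matrix_mul[of A B] by (simp add: rotation_matrix_def det_mul)

lemma rotation_matrix_transpose: "rotation_matrix A \<Longrightarrow> rotation_matrix (transpose A)"
  by (simp add: rotation_matrix_def)

lemma rotation_matrix_inverse:
  assumes "rotation_matrix A"
  shows "A ** transpose A = mat 1" "transpose A ** A = mat 1"
  using assms by (auto simp: rotation_matrix_def orthogonal_matrix_def)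

text \<open>\<open>matrix_inv\<close> is a choice among two-sided inverses, so it satisfies the
  inverse laws once \<open>B\<close> shows that one exists; associativity then identifies it with
  \<open>B\<close>.\<close>

lemma matrix_inv_unique:
  assumes "A ** B = mat 1" "B ** A = mat 1"
  shows "matrix_inv A = (B :: real^'n^'n)"
proof -
  have "invertible A"
    using assms by (auto simp: invertible_def)
  then have "matrix_inv A ** A = mat 1"
    unfolding invertible_def matrix_inv_def by (rule someI2_ex) blast
  then show ?thesis
    using assms by (metis matrix_mul_assoc matrix_mul_lid matrix_mul_rid)
qed

lemma matrix_inv_pose:
  assumes "rotation_matrix R"
  shows "matrix_inv (pose R b) = pose (transpose R) (- (transpose R *v b))"
proof (rule matrix_inv_unique)
  have *: "pose (mat 1) 0 = mat 1"
    by (simp add: pose_def mat_1_block columnvector_simps)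
  show "pose R b ** pose (transpose R) (- (transpose R *v b)) = mat 1"
    using rotation_matrix_inverse[OF assms] *
    by (simp add: pose_mult matrix_vector_mul_assoc matvec.minus_right del: transpose_matrix_vector)
  show "pose (transpose R) (- (transpose R *v b)) ** pose R b = mat 1"
    using rotation_matrix_inverse[OF assms] * by (simp add: pose_mult)
qed

lemma SE3_pose: "rotation_matrix R \<Longrightarrow> pose R b \<in> SE3"
  by (auto simp: SE3_def)

lemma SE3_E:
  assumes "q \<in> SE3"
  obtains Q x where "rotation_matrix Q" "q = pose Q x"
  using assms by (auto simp: SE3_def)

section \<open>Skew-symmetric matrices\<close>

text \<open>Explicit entries turn the later identities for skew matrices into componentwise
  checks.\<close>

lemma cross_mat_nth: "cross_mat a = vector [vector [0, -a$3, a$2], vector [a$3, 0, -a$1], vector [-a$2, a$1, 0]]"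
  by (simp add: cross_mat_def matrix_def cross3_def vec_eq_iff forall_3 axis_def)

lemma cross_mat_mult [simp]: "cross_mat a *v c = cross3 a c"
  by (simp add: cross_mat_nth cross3_def vec_eq_iff forall_3 matrix_vector_mult_def sum_3)

lemma transpose_cross_mat: "transpose (cross_mat a) = - cross_mat a"
  by (simp add: cross_mat_nth vec_eq_iff forall_3 transpose_def)

lemma cross_mat_0 [simp]: "cross_mat 0 = 0"
  by (simp add: cross_mat_nth vec_eq_iff forall_3)

lemma cross_mat_scaleR: "cross_mat (c *\<^sub>R a) = c *\<^sub>R cross_mat a"
  by (simp add: cross_mat_nth vec_eq_iff forall_3)

lemma bounded_linear_cross_mat: "bounded_linear cross_mat"
  by (simp add: linear_conv_bounded_linear [symmetric] linear_iff vec_eq_iff cross_mat_nth forall_3)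

lemma bounded_linear_ad: "bounded_linear ad"
  by (simp add: linear_conv_bounded_linear [symmetric] linear_iff ad_def vec_eq_iff all_UNIV_plus
      block_def ang_def lin_def cross_mat_nth forall_3)

lemma inj_cross_mat: "inj cross_mat"
proof
  fix a b assume "cross_mat a = cross_mat b"
  then show "a = b"
    by (simp add: cross_mat_nth vec_eq_iff forall_3)
qed

text \<open>The vector of the skew-symmetric matrix \<open>A - A\<^sup>T\<close>; unlike \<^const>\<open>vex\<close> it is linear on all
  matrices.\<close>

definition skew_vec :: "real^3^3 \<Rightarrow> real^3" where
  "skew_vec A = vector [A$3$2 - A$2$3, A$1$3 - A$3$1, A$2$1 - A$1$2]"

lemma bounded_linear_skew_vec: "bounded_linear skew_vec"
  by (simp add: linear_conv_bounded_linear [symmetric] linear_iff skew_vec_def vec_eq_iff forall_3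
      algebra_simps)

lemma vex_diff_transpose: "vex (A - transpose A) = skew_vec A"
proof -
  have "A - transpose A = cross_mat (skew_vec A)"
    by (simp add: cross_mat_nth skew_vec_def vec_eq_iff forall_3 transpose_def)
  then show ?thesis
    by (simp add: vex_def inj_cross_mat)
qed

text \<open>The entries of \<open>cross_mat w\<close> come in pairs
  \<open>\<plusminus> w $ k\<close>, and each pair picks up the difference of two mirrored entries
  of \<open>A\<close>. So \<open>skew_vec\<close> is the adjoint of \<open>cross_mat\<close>, which
  is how the rotational gradient becomes a vector.\<close>

lemma inner_skew_vec: "w \<bullet> skew_vec A = cross_mat w \<bullet> A"
  by (simp add: inner_vec_def sum_3 cross_mat_nth skew_vec_def algebra_simps)

text \<open>Needed to solve the definition of \<open>\<phi>\<close> for \<open>\<xi>h\<close>. The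
  lower left block vanishes because the rotation \<open>transpose R\<close> preserves cross
  products.\<close>

lemma Ad_matrix_inv_pose:
  assumes "rotation_matrix R"
  shows "Ad (matrix_inv (pose R b)) ** Ad (pose R b) = mat 1"
proof -
  note R = rotation_matrix_inverse[OF assms] rotation_matrix_transpose[OF assms]
  have "cross_mat (- (transpose R *v b)) ** transpose R + transpose R ** cross_mat b = 0"
    unfolding matrix_eq
    using cross_rotation_matrix[OF R(3), of b]
    by (simp add: matrix_vector_mul_assoc [symmetric] matrix_vector_mult_add_rdistrib)
  then have "cross_mat (- (transpose R *v b)) ** transpose R ** R + transpose R ** (cross_mat b ** R) = 0"
    by (simp add: matrix_mul_assoc flip: matmul.add_left)
  then show ?thesis
    by (simp add: matrix_inv_pose[OF assms] Ad_def block_mult mat_1_block block_eq_iff R)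
qed

section \<open>The trace pairing and adjoints of matrix multiplication\<close>

text \<open>Identifies the trace pairing with the library inner product of nested vectors, so that
  the derivative and continuity rules for the latter apply.\<close>

lemma mat_inner_eq_inner: "mat_inner A B = A \<bullet> B"
proof -
  have "mat_inner A B = (\<Sum>i\<in>UNIV. \<Sum>j\<in>UNIV. A $ j $ i * B $ j $ i)"
    by (simp add: mat_inner_def trace_def matrix_matrix_mult_def transpose_def)
  also have "\<dots> = A \<bullet> B"
    by (subst sum.swap) (simp add: inner_vec_def)
  finally show ?thesis .
qed

lemma inner_matrix_mult_left: "(X ** A) \<bullet> B = A \<bullet> (transpose X ** (B :: real^'n^'m))" 
  by (simp add: mat_inner_eq_inner [symmetric] mat_inner_def matrix_transpose_mul matrix_mul_assoc)

lemma inner_transpose: "transpose A \<bullet> transpose B = A \<bullet> (B :: real^'n^'m)"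
  by (simp add: inner_vec_def transpose_def) (rule sum.swap)

lemma inner_matrix_mult_right: "(A ** X) \<bullet> B = A \<bullet> ((B :: real^'n^'m) ** transpose X)"
proof -
  have "(A ** X) \<bullet> B = (transpose X ** transpose A) \<bullet> transpose B"
    by (simp only: inner_transpose matrix_transpose_mul [symmetric])
  also have "\<dots> = transpose A \<bullet> transpose (B ** transpose X)"
    by (simp only: inner_matrix_mult_left matrix_transpose_mul transpose_transpose)
  finally show ?thesis
    by (simp only: inner_transpose)
qed

lemma inner_mult_vec: "x \<bullet> (A *v y) = (transpose A *v x) \<bullet> (y :: real^'n)"
  by (metis dot_lmul_matrix transpose_matrix_vector)

section \<open>The Lagrangian as a function of the relative pose\<close>

lemmas [continuous_intros] =
  matmul.continuous_on matvec.continuous_on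
  bounded_linear.continuous_on [OF bounded_linear_transpose]
  bounded_linear.continuous_on [OF bounded_linear_rot]
  bounded_linear.continuous_on [OF bounded_linear_trans_part]
  bounded_linear.continuous_on [OF bounded_linear_skew_vec]

text \<open>The argument of \<open>\<Phi>\<close> as a function of the residual alone; at
  \<open>E = D - rot gh ** Lm\<close> it is \<open>U0r\<close>.\<close>

definition weighted_square :: "real^'n^'n \<Rightarrow> real^'n^'m \<Rightarrow> real" where
  "weighted_square W E = 1 / 2 * (E \<bullet> (E ** W))"

text \<open>\<open>\<Phi>\<close> is controlled only on the half-line, so its argument has to stay
  there. As \<open>W\<close> is symmetric, the form splits into one quadratic form of
  \<open>W\<close> for each row of \<open>E\<close>.\<close>

lemma weighted_square_nonneg:
  assumes "transpose W = W" "pos_def W"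
  shows "0 \<le> weighted_square W E"
proof -
  have row: "(E ** W) $ i = W *v (E $ i)" for i
  proof -
    have "(E ** W) $ i = transpose W *v (E $ i)"
      by (simp add: vec_eq_iff matrix_matrix_mult_def vector_matrix_mult_def mult.commute)
    with assms(1) show ?thesis
      by simp
  qed
  have "0 \<le> x \<bullet> (W *v x)" for x
    using assms(2) by (cases "x = 0") (auto simp: pos_def_def less_imp_le)
  then show ?thesis
    unfolding weighted_square_def
    by (subst inner_vec_def) (auto simp: row intro!: sum_nonneg)
qed

text \<open>Here the true pose \<open>(R, b)\<close> has carried the measurements to the inertial frame:
  \<open>M = R L\<^sup>m\<close> and \<open>c = R a\<^sup>m + b\<close>.\<close>

definition lab_lagrangian :: "real^(3 + 3)^(3 + 3) \<Rightarrow> (real \<Rightarrow> real) \<Rightarrow> real \<Rightarrow> real^'n^'n \<Rightarrow>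
    real^'n^3 \<Rightarrow> real^'n^3 \<Rightarrow> real^3 \<Rightarrow> real^3 \<Rightarrow> hmat \<Rightarrow> twist \<Rightarrow> real" where
  "lab_lagrangian J \<Phi> \<kappa> W M D c p q \<phi> =
     1 / 2 * (\<phi> \<bullet> (J *v \<phi>)) - \<Phi> (weighted_square W (D - transpose (rot q) ** M))
     - 1 / 2 * \<kappa> * (norm (p - transpose (rot q) *v (c - trans_part q)))\<^sup>2"

text \<open>The differential of \<open>lab_lagrangian\<close> at \<open>(q, \<phi>)\<close> in the
  direction \<open>(dq, d\<phi>)\<close>. The plus sign before \<open>dPhi\<close> comes from the
  residual, which changes by \<open>- transpose (rot dq) ** M\<close>.\<close>

definition lab_lagrangian_deriv :: "real^(3 + 3)^(3 + 3) \<Rightarrow> (real \<Rightarrow> real) \<Rightarrow> real \<Rightarrow> real^'n^'n \<Rightarrow>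
    real^'n^3 \<Rightarrow> real^'n^3 \<Rightarrow> real^3 \<Rightarrow> real^3 \<Rightarrow> hmat \<Rightarrow> twist \<Rightarrow> hmat \<Rightarrow> twist \<Rightarrow> real" where
  "lab_lagrangian_deriv J dPhi \<kappa> W M D c p q \<phi> dq d\<phi> =
     (let E = D - transpose (rot q) ** M; y = p - transpose (rot q) *v (c - trans_part q)
      in d\<phi> \<bullet> (J *v \<phi>) + dPhi (weighted_square W E) * ((transpose (rot dq) ** M) \<bullet> (E ** W))
         - \<kappa> * ((transpose (rot q) *v trans_part dq - transpose (rot dq) *v (c - trans_part q)) \<bullet> y))"

text \<open>With \<open>q = pose Q x\<close>, the estimate has rotation
  \<open>transpose Q ** R\<close> and translation \<open>transpose Q *v (b - x)\<close>;
  substituting these leaves the true pose only in the combinations \<open>R ** Lm\<close> and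
  \<open>R *v am + b\<close>.\<close>

lemma measured_lagrangian_inverse:
  assumes "q \<in> SE3" "rotation_matrix R"
  shows "measured_lagrangian J \<Phi> \<kappa> W (matrix_inv q ** pose R b) Lm D am p \<phi> =
    lab_lagrangian J \<Phi> \<kappa> W (R ** Lm) D (R *v am + b) p q \<phi>"
proof -
  obtain Q x where q: "rotation_matrix Q" "q = pose Q x"
    using assms(1) by (rule SE3_E)
  have eq: "p - (transpose Q ** R) *v am - (transpose Q *v b - transpose Q *v x) =
      p - transpose Q *v (R *v am + b - x)"
    by (simp add: matvec.add_right matvec.diff_right matrix_vector_mul_assoc del: transpose_matrix_vector)
  show ?thesis
    by (simp add: q eq matrix_inv_pose pose_mult measured_lagrangian_def lab_lagrangian_def
        weighted_square_def mat_inner_eq_inner matrix_mul_assoc del: transpose_matrix_vector)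
qed

text \<open>Expanding the square gives four pairings. The two pure terms equal
  \<open>mat 1 \<bullet> K\<close>, one of them by orthogonality of \<open>Q\<close>; the two mixed
  terms equal \<open>Q \<bullet> K\<close> because \<open>K\<close> is symmetric. The factor one
  half then leaves the pairing of \<open>mat 1 - Q\<close> with \<open>K\<close>.\<close>

lemma reduced_lagrangian_eq:
  assumes "q \<in> SE3" "transpose W = W"
  shows "reduced_lagrangian J \<Phi> \<kappa> W q D p \<phi> = lab_lagrangian J \<Phi> \<kappa> W D D p p q \<phi>"
proof -
  obtain Q x where q: "rotation_matrix Q" "q = pose Q x"
    using assms(1) by (rule SE3_E)
  note Q = rotation_matrix_inverse [OF q(1)]
  define K where "K = D ** W ** transpose D"
  have K: "transpose K = K"
    by (simp add: K_def matrix_transpose_mul assms(2) matrix_mul_assoc)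
  have 1: "D \<bullet> (D ** W) = mat 1 \<bullet> K"
    using inner_matrix_mult_right[of "mat 1" D "D ** W"] by (simp add: K_def)
  have 2: "(transpose Q ** D) \<bullet> (D ** W) = transpose Q \<bullet> K"
    by (simp add: K_def inner_matrix_mult_right)
  have 3: "D \<bullet> (transpose Q ** D ** W) = transpose Q \<bullet> K"
  proof -
    have "D \<bullet> (transpose Q ** D ** W) = (Q ** D) \<bullet> (D ** W)"
      by (simp add: inner_matrix_mult_left matrix_mul_assoc)
    also have "\<dots> = Q \<bullet> K"
      by (simp add: K_def inner_matrix_mult_right)
    also have "\<dots> = transpose Q \<bullet> K"
      by (metis K inner_transpose)
    finally show ?thesis .
  qed
  have 4: "(transpose Q ** D) \<bullet> (transpose Q ** D ** W) = mat 1 \<bullet> K"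
    using 1 by (simp add: inner_matrix_mult_left matrix_mul_assoc Q)
  have 5: "transpose Q \<bullet> K = Q \<bullet> K"
    by (metis K inner_transpose)
  have "weighted_square W (D - transpose Q ** D) = mat_inner (mat 1 - Q) K"
    by (simp add: weighted_square_def mat_inner_eq_inner matmul.diff_left inner_diff_left
        inner_diff_right 1 2 3 4) (simp add: 5)
  moreover have "transpose Q *v x + (mat 1 - transpose Q) *v p = p - transpose Q *v (p - x)"
    by (simp add: matvec.diff_right matvec.diff_left del: transpose_matrix_vector)
  ultimately show ?thesis
    by (simp add: q reduced_lagrangian_def lab_lagrangian_def Let_def K_def [symmetric]
        power2_norm_eq_inner del: transpose_matrix_vector)
qed

text \<open>Self-adjointness of \<open>B\<close> makes the two terms of the product rule equal,
  which cancels the factor one half. It is applied with \<open>B\<close> given by \<open>W\<close>,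
  by \<open>J\<close> and by the identity.\<close>

lemma symmetric_form_has_derivative:
  assumes "(f has_vector_derivative f') (at s within S)"
    and "bounded_linear B" "\<And>x y. x \<bullet> B y = B x \<bullet> y"
  shows "((\<lambda>s. 1 / 2 * (f s \<bullet> B (f s))) has_real_derivative f' \<bullet> B (f s)) (at s within S)"
proof -
  have "((\<lambda>s. f s \<bullet> B (f s)) has_vector_derivative f s \<bullet> B f' + f' \<bullet> B (f s)) (at s within S)"
    by (intro bounded_bilinear.has_vector_derivative [OF bounded_bilinear_inner] assms
        bounded_linear.has_vector_derivative [OF assms(2)])
  moreover have "f s \<bullet> B f' = f' \<bullet> B (f s)"
    by (simp add: assms(3) inner_commute)
  ultimately show ?thesis
    unfolding has_real_derivative_iff_has_vector_derivative [symmetric]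
    by (auto intro!: derivative_eq_intros)
qed

lemma weighted_square_has_derivative:
  assumes "(E has_vector_derivative E') (at s within S)" "transpose W = W"
  shows "((\<lambda>s. weighted_square W (E s)) has_real_derivative E' \<bullet> (E s ** W)) (at s within S)"
  unfolding weighted_square_def
  by (rule symmetric_form_has_derivative [OF assms(1) matmul.bounded_linear_left])
    (simp add: inner_matrix_mult_right assms(2))

lemma lab_lagrangian_has_derivative:
  assumes W: "transpose W = W" "pos_def W" and J: "transpose J = J"
    and \<Phi>: "\<And>s. s \<ge> 0 \<Longrightarrow> (\<Phi> has_real_derivative dPhi s) (at s within {0..})"
    and q: "(q has_vector_derivative dq) (at s within S)"
    and \<phi>: "(\<phi> has_vector_derivative d\<phi>) (at s within S)"
  shows "((\<lambda>s. lab_lagrangian J \<Phi> \<kappa> W M D c p (q s) (\<phi> s)) has_real_derivative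
    lab_lagrangian_deriv J dPhi \<kappa> W M D c p (q s) (\<phi> s) dq d\<phi>) (at s within S)"
proof -
  define E where "E s = D - transpose (rot (q s)) ** M" for s
  define y where "y s = p - transpose (rot (q s)) *v (c - trans_part (q s))" for s
  note Q = bounded_linear.has_vector_derivative [OF bounded_linear_transpose
      bounded_linear.has_vector_derivative [OF bounded_linear_rot q]]
  note x = bounded_linear.has_vector_derivative [OF bounded_linear_trans_part q]
  have "(E has_vector_derivative 0 - transpose (rot dq) ** M) (at s within S)"
    unfolding E_def
    by (intro has_vector_derivative_diff has_vector_derivative_const
        bounded_linear.has_vector_derivative [OF matmul.bounded_linear_left Q])
  then have E: "((\<lambda>s. weighted_square W (E s)) has_real_derivative
      - ((transpose (rot dq) ** M) \<bullet> (E s ** W))) (at s within S)"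
    using weighted_square_has_derivative [OF _ W(1)] by fastforce
  \<comment> \<open>The derivative of \<open>\<Phi>\<close> is given only within the half-line, so
    the chain rule is applied within the image of \<open>S\<close>, which lies there.\<close>
  have "(\<Phi> has_real_derivative dPhi (weighted_square W (E s)))
      (at (weighted_square W (E s)) within (\<lambda>s. weighted_square W (E s)) ` S)"
    by (rule has_field_derivative_subset [OF \<Phi>]) (auto simp: weighted_square_nonneg W)
  from DERIV_image_chain [OF this E]
  have 1: "((\<lambda>s. \<Phi> (weighted_square W (E s))) has_real_derivative
      dPhi (weighted_square W (E s)) * - ((transpose (rot dq) ** M) \<bullet> (E s ** W))) (at s within S)"
    by (simp add: o_def)
  have "(y has_vector_derivative 0 - (transpose (rot (q s)) *v (0 - trans_part dq)
      + transpose (rot dq) *v (c - trans_part (q s)))) (at s within S)"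
    unfolding y_def
    by (intro has_vector_derivative_diff has_vector_derivative_const matvec.has_vector_derivative Q x)
  then have "(y has_vector_derivative transpose (rot (q s)) *v trans_part dq
      - transpose (rot dq) *v (c - trans_part (q s))) (at s within S)"
    by (simp add: matvec.minus_right del: transpose_matrix_vector)
  from symmetric_form_has_derivative [OF this bounded_linear_ident]
  have 2: "((\<lambda>s. 1 / 2 * (norm (y s))\<^sup>2) has_real_derivative (transpose (rot (q s)) *v trans_part dq
      - transpose (rot dq) *v (c - trans_part (q s))) \<bullet> y s) (at s within S)"
    by (simp add: power2_norm_eq_inner del: transpose_matrix_vector)
  have 3: "((\<lambda>s. 1 / 2 * (\<phi> s \<bullet> (J *v \<phi> s))) has_real_derivative d\<phi> \<bullet> (J *v \<phi> s)) (at s within S)"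
    by (rule symmetric_form_has_derivative [OF \<phi> matvec.bounded_linear_right])
      (simp add: inner_mult_vec J del: transpose_matrix_vector)
  have "((\<lambda>s. 1 / 2 * (\<phi> s \<bullet> (J *v \<phi> s)) - \<Phi> (weighted_square W (E s)) - \<kappa> * (1 / 2 * (norm (y s))\<^sup>2))
      has_real_derivative d\<phi> \<bullet> (J *v \<phi> s)
      - dPhi (weighted_square W (E s)) * - ((transpose (rot dq) ** M) \<bullet> (E s ** W))
      - \<kappa> * ((transpose (rot (q s)) *v trans_part dq
      - transpose (rot dq) *v (c - trans_part (q s))) \<bullet> y s)) (at s within S)"
    by (intro DERIV_diff 1 3 DERIV_cmult 2)
  then show ?thesis
    by (simp add: lab_lagrangian_def lab_lagrangian_deriv_def Let_def E_def y_def mult_ac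
        del: transpose_matrix_vector)
qed

section \<open>Continuity of the Lagrangian and of its differential\<close>

lemma continuous_on_weighted_square [continuous_intros]:
  "continuous_on S E \<Longrightarrow> continuous_on S (\<lambda>s. weighted_square W (E s))"
  unfolding weighted_square_def by (intro continuous_intros) auto

lemma continuous_on_nonneg_compose_weighted_square:
  assumes "transpose W = W" "pos_def W" "continuous_on {0..} f" "continuous_on S E"
  shows "continuous_on S (\<lambda>s. f (weighted_square W (E s)))"
  by (rule continuous_on_compose2 [OF assms(3)])
    (auto intro!: continuous_intros assms weighted_square_nonneg)

lemma continuous_on_lab_lagrangian:
  assumes "transpose W = W" "pos_def W" "continuous_on {0..} \<Phi>"
    and "continuous_on S M" "continuous_on S D" "continuous_on S c" "continuous_on S p"
    and "continuous_on S q" "continuous_on S \<phi>"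
  shows "continuous_on S (\<lambda>s. lab_lagrangian J \<Phi> \<kappa> W (M s) (D s) (c s) (p s) (q s) (\<phi> s))"
  unfolding lab_lagrangian_def
  by (intro continuous_on_diff continuous_on_mult continuous_on_const continuous_on_power
      continuous_on_norm continuous_on_inner continuous_on_nonneg_compose_weighted_square
      matvec.continuous_on matmul.continuous_on assms
      bounded_linear.continuous_on [OF bounded_linear_transpose]
      bounded_linear.continuous_on [OF bounded_linear_rot]
      bounded_linear.continuous_on [OF bounded_linear_trans_part])

lemma continuous_on_lab_lagrangian_deriv:
  assumes "transpose W = W" "pos_def W" "continuous_on {0..} dPhi"
    and "continuous_on S M" "continuous_on S D" "continuous_on S c" "continuous_on S p"
    and "continuous_on S q" "continuous_on S \<phi>" "continuous_on S dq" "continuous_on S d\<phi>"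
  shows "continuous_on S (\<lambda>s. lab_lagrangian_deriv J dPhi \<kappa> W (M s) (D s) (c s) (p s)
    (q s) (\<phi> s) (dq s) (d\<phi> s))"
  unfolding lab_lagrangian_deriv_def Let_def
  by (intro continuous_on_diff continuous_on_add continuous_on_mult continuous_on_const
      continuous_on_inner continuous_on_nonneg_compose_weighted_square
      matvec.continuous_on matmul.continuous_on assms
      bounded_linear.continuous_on [OF bounded_linear_transpose]
      bounded_linear.continuous_on [OF bounded_linear_rot]
      bounded_linear.continuous_on [OF bounded_linear_trans_part])

section \<open>The force as the gradient of the potential\<close>

text \<open>The two products are transposes of each other, so the argument of \<open>vex\<close> is
  skew-symmetric. The form on the right is linear in the matrix, hence visibly continuous.\<close>

lemma S_Gamma_eq: "S_Gamma \<Gamma> Rh = skew_vec (\<Gamma> ** transpose Rh)"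
  using vex_diff_transpose [of "\<Gamma> ** transpose Rh"]
  by (simp add: S_Gamma_def matrix_transpose_mul)

lemma skew_vec_symmetric:
  assumes "transpose A = A"
  shows "skew_vec A = 0"
proof -
  have "A $ i $ j = A $ j $ i" for i j
    using arg_cong [OF assms, of "\<lambda>A. A $ i $ j"] by (simp add: transpose_def)
  then show ?thesis
    by (simp add: skew_vec_def vec_eq_iff forall_3)
qed

text \<open>The point where \<open>Z\<close> arises: for \<open>dq = h ** hat \<eta>\<close> the
  potential part of the differential is linear in the two parts \<open>w\<close> and
  \<open>v\<close> of \<open>\<eta>\<close>, and its coefficients are the blocks of
  \<open>- Z\<close>.\<close>

lemma lab_lagrangian_deriv_reduced_variation:
  assumes "transpose W = W" "h \<in> SE3" "rotation_matrix R"
  shows "lab_lagrangian_deriv J dPhi \<kappa> W (R ** Lm) D (R *v am + b) p h \<phi> (h ** hat \<eta>) d\<phi> =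
    d\<phi> \<bullet> (J *v \<phi>) - \<eta> \<bullet> Z dPhi \<kappa> W (matrix_inv h ** pose R b) Lm D am p"
proof -
  obtain Q x where q: "rotation_matrix Q" "h = pose Q x"
    using assms(2) by (rule SE3_E)
  note Q = rotation_matrix_inverse [OF q(1)]
  define gh where "gh = matrix_inv h ** pose R b"
  have rot_gh: "rot gh = transpose Q ** R" and trans_gh: "trans_part gh = transpose Q *v b - transpose Q *v x"
    by (simp_all add: gh_def q matrix_inv_pose pose_mult del: transpose_matrix_vector)
  define N where "N = transpose Q ** R ** Lm"
  define E where "E = D - N"
  define y where "y = pos_err gh am p"
  define w where "w = ang \<eta>"
  define v where "v = lin \<eta>"
  have N: "transpose Q ** (R ** Lm) = N" "rot gh ** Lm = N"
    by (simp_all add: N_def matrix_mul_assoc rot_gh)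
  have y: "p - transpose Q *v (R *v am + b - x) = y"
    by (simp add: y_def pos_err_def rot_gh trans_gh matvec.add_right matvec.diff_right
        matrix_vector_mul_assoc del: transpose_matrix_vector)
  \<comment> \<open>Transposition moves the skew matrix to the left of \<open>transpose Q\<close>
    and flips its sign.\<close>
  have drot: "transpose (rot (h ** hat \<eta>)) = - (cross_mat w ** transpose Q)"
    by (simp add: q rot_mult_hat matrix_transpose_mul transpose_cross_mat matmul.minus_left w_def)
  have dtrans: "trans_part (h ** hat \<eta>) = Q *v v"
    by (simp add: q trans_part_mult_hat v_def)
  have "(cross_mat w ** N) \<bullet> (E ** W) = w \<bullet> skew_vec (E ** W ** transpose N)"
    by (simp add: inner_matrix_mult_right inner_skew_vec)
  also have "skew_vec (E ** W ** transpose N) = skew_vec (D ** W ** transpose N)"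
  proof -
    have "skew_vec (N ** W ** transpose N) = 0"
      by (rule skew_vec_symmetric) (simp add: matrix_transpose_mul assms(1) matrix_mul_assoc)
    then show ?thesis
      by (simp add: E_def matmul.diff_left linear_diff [OF bounded_linear.linear [OF bounded_linear_skew_vec]])
  qed
  also have "D ** W ** transpose N = D ** W ** transpose Lm ** transpose (rot gh)"
    by (simp add: N(2) [symmetric] matrix_transpose_mul matrix_mul_assoc)
  finally have 1: "(cross_mat w ** N) \<bullet> (E ** W) = w \<bullet> S_Gamma (D ** W ** transpose Lm) (rot gh)"
    by (simp add: S_Gamma_eq)
  \<comment> \<open>\<open>cross3 w y\<close> is orthogonal to \<open>y\<close>, so the
    \<open>y\<close> inside the cross product drops out; cyclicity of the triple product does the
    rest.\<close>
  have "(v + cross3 w (p - y)) \<bullet> y = v \<bullet> y + w \<bullet> cross3 p y"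
    by (simp add: cross3_simps)
  moreover have "transpose Q *v (R *v am + b - x) = p - y"
    by (simp add: y [symmetric] del: transpose_matrix_vector)
  ultimately have 2: "(transpose Q *v (Q *v v) + cross_mat w *v (transpose Q *v (R *v am + b - x))) \<bullet> y
      = v \<bullet> y + w \<bullet> cross3 p y"
    by (simp add: matrix_vector_mul_assoc Q del: transpose_matrix_vector)
  have U: "weighted_square W E = U0r W gh Lm D"
    by (simp add: U0r_def weighted_square_def E_def N mat_inner_eq_inner)
  have "\<eta> = stack w v"
    by (simp add: w_def v_def)
  then have 3: "\<eta> \<bullet> Z dPhi \<kappa> W gh Lm D am p =
      dPhi (weighted_square W E) * (w \<bullet> S_Gamma (D ** W ** transpose Lm) (rot gh))
      + \<kappa> * (v \<bullet> y + w \<bullet> cross3 p y)"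
    by (simp add: Z_def Let_def inner_stack y_def [symmetric] U inner_add_right algebra_simps)
  have "lab_lagrangian_deriv J dPhi \<kappa> W (R ** Lm) D (R *v am + b) p h \<phi> (h ** hat \<eta>) d\<phi> =
     d\<phi> \<bullet> (J *v \<phi>) + dPhi (weighted_square W E) * - ((cross_mat w ** N) \<bullet> (E ** W))
     - \<kappa> * ((transpose Q *v (Q *v v) + cross_mat w *v (transpose Q *v (R *v am + b - x))) \<bullet> y)"
    unfolding lab_lagrangian_deriv_def Let_def drot dtrans
    by (simp add: q N y E_def [symmetric] matmul.minus_left matvec.minus_left
        matrix_mul_assoc [symmetric] matrix_vector_mul_assoc [symmetric] del: transpose_matrix_vector cross_mat_mult)
  then show ?thesis
    unfolding gh_def [symmetric] 1 2 3 by simp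
qed

section \<open>Realizing variations along a fixed direction\<close>

text \<open>For a unit vector \<open>w\<close> this is Rodrigues' formula for the exponential of
  \<open>\<theta> *\<^sub>R cross_mat w\<close>; for \<open>w = 0\<close> it is the identity. The
  closed form reduces the group law and the derivative to trigonometry.\<close>

definition rodrigues :: "real^3 \<Rightarrow> real \<Rightarrow> real^3^3" where
  "rodrigues w \<theta> = mat 1 + sin \<theta> *\<^sub>R cross_mat w + (1 - cos \<theta>) *\<^sub>R (cross_mat w ** cross_mat w)"

text \<open>\<open>cross3 w x\<close> is orthogonal to the unit vector \<open>w\<close>, and on
  vectors orthogonal to \<open>w\<close> the double cross product with \<open>w\<close> is
  negation.\<close>

lemma cross_mat_cube:
  assumes "norm w = 1"
  shows "cross_mat w ** cross_mat w ** cross_mat w = - cross_mat w"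
proof -
  have "cross3 w (cross3 w (cross3 w x)) = - cross3 w x" for x
  proof -
    have "w \<bullet> w = 1"
      using assms by (simp add: norm_eq_1)
    then show ?thesis
      using Lagrange [of w w "cross3 w x"] by (simp add: dot_cross_self)
  qed
  then show ?thesis
    unfolding matrix_eq by (simp add: matrix_vector_mul_assoc [symmetric] matvec.minus_left)
qed

text \<open>By the cube identity the span of \<open>mat 1\<close>, \<open>A\<close> and
  \<open>A ** A\<close> is closed under products, and the product reduces to the addition formulas
  for sine and cosine.\<close>

lemma rodrigues_mult:
  assumes "norm w = 1"
  shows "rodrigues w \<alpha> ** rodrigues w \<beta> = rodrigues w (\<alpha> + \<beta>)"
proof -
  define A where "A = cross_mat w"
  define B where "B = A ** A"
  have 1: "A ** B = - A" "B ** A = - A"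
    using cross_mat_cube [OF assms] by (simp_all add: A_def B_def matrix_mul_assoc)
  have 2: "B ** B = - B"
    using 1 by (simp add: B_def matrix_mul_assoc matmul.minus_left)
  have "rodrigues w \<alpha> ** rodrigues w \<beta> = mat 1 + (sin \<alpha> * cos \<beta> + cos \<alpha> * sin \<beta>) *\<^sub>R A
      + (1 - (cos \<alpha> * cos \<beta> - sin \<alpha> * sin \<beta>)) *\<^sub>R B"
    unfolding rodrigues_def A_def [symmetric] B_def [symmetric]
    by (simp add: matmul.add_left matmul.add_right matmul.scaleR_left matmul.scaleR_right 1 2
        B_def [symmetric]) (simp add: algebra_simps)
  then show ?thesis
    by (simp add: rodrigues_def A_def B_def sin_add cos_add)
qed

lemma transpose_rodrigues: "transpose (rodrigues w \<theta>) = rodrigues w (- \<theta>)"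
proof -
  note t = bounded_linear.linear [OF bounded_linear_transpose]
  show ?thesis
    by (simp add: rodrigues_def linear_add [OF t] linear_cmul [OF t] transpose_cross_mat
        matrix_transpose_mul matmul.minus_left matmul.minus_right)
qed

lemma rodrigues_0 [simp]: "rodrigues w 0 = mat 1" "rodrigues 0 \<theta> = mat 1"
  by (simp_all add: rodrigues_def matmul.zero_left)

lemma rotation_matrix_rodrigues:
  assumes "w = 0 \<or> norm w = 1"
  shows "rotation_matrix (rodrigues w \<theta>)"
proof (cases "w = 0")
  case True
  then show ?thesis
    by (simp add: rotation_matrix_def orthogonal_matrix_id)
next
  case False
  then have w: "norm w = 1"
    using assms by simp
  \<comment> \<open>Transposition reverses the angle, so the group law gives angle 0.\<close>
  have orth: "orthogonal_matrix (rodrigues w \<alpha>)" for \<alpha>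
    by (simp add: orthogonal_matrix_def transpose_rodrigues rodrigues_mult w)
  \<comment> \<open>the determinant \<open>\<plusminus>1\<close> is a square, since the rotation by \<open>\<theta>\<close> is that by \<open>\<theta>/2\<close> twice\<close>
  have "det (rodrigues w \<theta>) = det (rodrigues w (\<theta> / 2)) * det (rodrigues w (\<theta> / 2))"
    by (simp add: det_mul [symmetric] rodrigues_mult w)
  also have "\<dots> = 1"
    using det_orthogonal_matrix [OF orth, of "\<theta> / 2"] by auto
  finally show ?thesis
    using orth by (simp add: rotation_matrix_def)
qed

definition rodrigues_deriv :: "real^3 \<Rightarrow> real \<Rightarrow> real^3^3" where
  "rodrigues_deriv w \<theta> = cos \<theta> *\<^sub>R cross_mat w + sin \<theta> *\<^sub>R (cross_mat w ** cross_mat w)"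

lemma rodrigues_has_derivative:
  "((\<lambda>s. rodrigues w (s * r)) has_vector_derivative r *\<^sub>R rodrigues_deriv w (s * r)) (at s)"
  unfolding rodrigues_def rodrigues_deriv_def
  by (auto intro!: derivative_eq_intros simp: scaleR_add_right mult.commute)

text \<open>The linear part of \<open>pose\<close>, which is itself only affine because of its
  constant corner entry 1. Derivatives and continuity are proved for \<open>tangent\<close> and
  transferred by adding a constant block.\<close>

definition tangent :: "real^3^3 \<Rightarrow> real^3 \<Rightarrow> hmat" where
  "tangent A b = block A (columnvector b) 0 0"

lemma pose_eq_tangent: "pose R b = tangent R b + block 0 0 0 (mat 1)"
  by (simp add: pose_def tangent_def vec_eq_iff all_UNIV_plus block_def)

lemma bounded_linear_tangent: "bounded_linear (\<lambda>x. tangent (fst x) (snd x))"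
  unfolding linear_conv_bounded_linear [symmetric] linear_iff tangent_def
  by (auto simp: vec_eq_iff all_UNIV_plus block_def columnvector_def)

lemma tangent_has_vector_derivative:
  assumes "(A has_vector_derivative A') (at x within S)" "(b has_vector_derivative b') (at x within S)"
  shows "((\<lambda>s. tangent (A s) (b s)) has_vector_derivative tangent A' b') (at x within S)"
  using bounded_linear.has_vector_derivative [OF bounded_linear_tangent
      has_vector_derivative_Pair [OF assms]] by simp

lemma continuous_on_tangent [continuous_intros]:
  assumes "continuous_on S A" "continuous_on S b"
  shows "continuous_on S (\<lambda>s. tangent (A s) (b s))"
  using bounded_linear.continuous_on [OF bounded_linear_tangent
      continuous_on_Pair [OF assms]] by simp

text \<open>Beyond its regularity, \<open>P\<close> has only its value and its first-order part at
  \<open>\<epsilon> = 0\<close> prescribed, so it is taken affine in \<open>\<epsilon>\<close>.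
  \<open>H\<close> has to stay in \<open>SE3\<close>, whence the rotation; the condition on
  \<open>ang \<zeta>\<close> ensures that \<open>rodrigues\<close> is one.\<close>

lemma realizes_variation_direction:
  fixes \<rho> d\<rho> :: "real \<Rightarrow> real"
  assumes h: "\<And>t. t \<in> {t0..T} \<Longrightarrow> h t \<in> SE3" "continuous_on {t0..T} h"
    and \<phi>: "continuous_on {t0..T} \<phi>"
    and \<rho>: "continuous_on {t0..T} \<rho>" "continuous_on {t0..T} d\<rho>"
    and \<zeta>: "ang \<zeta> = 0 \<or> norm (ang \<zeta>) = 1"
  shows "realizes_variation t0 T h \<phi> (\<lambda>t. \<rho> t *\<^sub>R \<zeta>) (\<lambda>t. d\<rho> t *\<^sub>R \<zeta>)
    (\<lambda>\<epsilon> t. h t ** pose (rodrigues (ang \<zeta>) (\<epsilon> * \<rho> t)) ((\<epsilon> * \<rho> t) *\<^sub>R lin \<zeta>))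
    (\<lambda>\<epsilon> t. \<phi> t + \<epsilon> *\<^sub>R (d\<rho> t *\<^sub>R \<zeta> + ad (\<phi> t) *v (\<rho> t *\<^sub>R \<zeta>)))"
proof -
  define w v where "w = ang \<zeta>" and "v = lin \<zeta>"
  define H where "H = (\<lambda>\<epsilon> t. h t ** pose (rodrigues w (\<epsilon> * \<rho> t)) ((\<epsilon> * \<rho> t) *\<^sub>R v))"
  define dH where "dH = (\<lambda>\<epsilon> t. h t ** tangent (\<rho> t *\<^sub>R rodrigues_deriv w (\<epsilon> * \<rho> t)) (\<rho> t *\<^sub>R v))"
  define dP where "dP = (\<lambda>t. d\<rho> t *\<^sub>R \<zeta> + ad (\<phi> t) *v (\<rho> t *\<^sub>R \<zeta>))"
  have dP: "continuous_on {t0..T} dP"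
    unfolding dP_def by (intro continuous_intros \<phi> \<rho> bounded_linear.continuous_on [OF bounded_linear_ad])
  have snd: "continuous_on ({-1<..<1} \<times> {t0..T}) (\<lambda>x. f (snd x))"
    if "continuous_on {t0..T} f" for f :: "real \<Rightarrow> 'b::real_normed_vector"
    by (rule continuous_on_compose2 [OF that]) (auto intro!: continuous_intros)
  have rod: "continuous_on S (\<lambda>x. rodrigues w (f x))" "continuous_on S (\<lambda>x. rodrigues_deriv w (f x))"
    if "continuous_on S f" for S and f :: "real \<times> real \<Rightarrow> real"
    unfolding rodrigues_def rodrigues_deriv_def by (intro continuous_intros that)+
  have "H \<epsilon> t \<in> SE3" if t: "t \<in> {t0..T}" for \<epsilon> t
  proof -
    obtain Q x where q: "rotation_matrix Q" "h t = pose Q x"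
      using h(1) [OF t] by (rule SE3_E)
    then show ?thesis
      using \<zeta> by (simp add: H_def w_def pose_mult SE3_pose rotation_matrix_mult rotation_matrix_rodrigues)
  qed
  moreover have "((\<lambda>s. H s t) has_vector_derivative dH \<epsilon> t) (at \<epsilon>)" for \<epsilon> t
    unfolding H_def dH_def pose_eq_tangent
    by (intro bounded_linear.has_vector_derivative [OF matmul.bounded_linear_right])
      (auto intro!: derivative_eq_intros tangent_has_vector_derivative rodrigues_has_derivative)
  moreover have "((\<lambda>s. \<phi> t + s *\<^sub>R dP t) has_vector_derivative dP t) (at \<epsilon>)" for \<epsilon> t
    by (auto intro!: derivative_eq_intros)
  moreover have "continuous_on ({-1<..<1} \<times> {t0..T}) (\<lambda>(\<epsilon>, t). H \<epsilon> t)"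
    unfolding H_def pose_eq_tangent split_def by (intro continuous_intros rod snd h \<rho>)
  moreover have "continuous_on ({-1<..<1} \<times> {t0..T}) (\<lambda>(\<epsilon>, t). dH \<epsilon> t)"
    unfolding dH_def split_def by (intro continuous_intros rod snd h \<rho>)
  moreover have "continuous_on ({-1<..<1} \<times> {t0..T}) (\<lambda>(\<epsilon>, t). \<phi> t + \<epsilon> *\<^sub>R dP t)"
    unfolding split_def by (intro continuous_intros snd \<phi> dP)
  moreover have "continuous_on ({-1<..<1} \<times> {t0..T}) (\<lambda>(\<epsilon>, t). dP t)"
    unfolding split_def by (intro snd dP)
  moreover have "H 0 t = h t" for t
    by (simp add: H_def pose_def mat_1_block [symmetric] columnvector_simps)
  moreover have "dH 0 t = h t ** hat (\<rho> t *\<^sub>R \<zeta>)" for t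
  proof -
    have "ang (\<rho> t *\<^sub>R \<zeta>) = \<rho> t *\<^sub>R w" "lin (\<rho> t *\<^sub>R \<zeta>) = \<rho> t *\<^sub>R v"
      by (simp_all add: ang_def lin_def w_def v_def vec_eq_iff)
    then show ?thesis
      by (simp add: dH_def tangent_def hat_def rodrigues_deriv_def cross_mat_scaleR)
  qed
  \<comment> \<open>The family is defined for every \<open>\<epsilon>\<close>; the radius 1 is an
    arbitrary choice.\<close>
  ultimately show ?thesis
    unfolding realizes_variation_def w_def [symmetric] v_def [symmetric] H_def [symmetric]
      dP_def [symmetric]
    by (intro exI [of _ 1] exI [of _ dH] exI [of _ "\<lambda>\<epsilon>. dP"]) (auto simp: dP_def)
qed

section \<open>The fundamental lemma of the calculus of variations\<close>

text \<open>Squaring smooths the corner of \<open>max 0 x\<close> at the origin, which makes the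
  bump function built from it continuously differentiable.\<close>

lemma truncated_square_has_derivative:
  "((\<lambda>x::real. (max 0 x)\<^sup>2) has_real_derivative 2 * max 0 x) (at x)"
proof (cases x "0::real" rule: linorder_cases)
  case less
  have "((\<lambda>x::real. (max 0 x)\<^sup>2) has_real_derivative 0) (at x)"
    by (rule has_field_derivative_transform_within_open [where f = "\<lambda>_. 0" and S = "{..<0}"])
      (use less in auto)
  with less show ?thesis by simp
next
  case equal
  have "(\<lambda>h::real. max 0 h) \<midarrow>0\<rightarrow> max 0 0"
    by (rule tendsto_max [OF tendsto_const tendsto_ident_at])
  \<comment> \<open>On either side of 0 the difference quotient equals
    \<open>max 0 h\<close>.\<close>
  moreover have "\<forall>\<^sub>F h::real in at 0. max 0 h = (max 0 h)\<^sup>2 / h"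
    by (auto simp: eventually_at_filter max_def power2_eq_square)
  ultimately have "(\<lambda>h::real. (max 0 h)\<^sup>2 / h) \<midarrow>0\<rightarrow> max 0 0"
    by (rule Lim_transform_eventually)
  then show ?thesis
    using equal by (simp add: DERIV_def)
next
  case greater
  have "((\<lambda>x::real. (max 0 x)\<^sup>2) has_real_derivative 2 * x) (at x)"
    by (rule has_field_derivative_transform_within_open [where f = "\<lambda>x. x\<^sup>2" and S = "{0<..}"])
      (use greater in \<open>auto intro!: derivative_eq_intros\<close>)
  with greater show ?thesis by simp
qed

text \<open>If \<open>F t\<close> were positive, \<open>F\<close> would be positive on an interval
  at \<open>t\<close>. Testing with a bump supported there gives a nonnegative continuous integrand
  with integral zero, hence zero throughout, although it is positive at the midpoint of the
  interval.\<close>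

lemma fundamental_lemma_of_variations_nonpos:
  fixes F :: "real \<Rightarrow> real"
  assumes F: "continuous_on {a..b} F" and ab: "a < b"
    and zero: "\<And>\<rho> d\<rho>. \<lbrakk>\<And>t. t \<in> {a..b} \<Longrightarrow> (\<rho> has_real_derivative d\<rho> t) (at t within {a..b});
      continuous_on {a..b} d\<rho>; \<rho> a = 0; \<rho> b = 0\<rbrakk> \<Longrightarrow> integral {a..b} (\<lambda>t. \<rho> t * F t) = 0"
    and t: "t \<in> {a..b}"
  shows "F t \<le> 0"
proof (rule ccontr)
  assume "\<not> F t \<le> 0"
  then have pos: "0 < F t" by simp
  obtain d where d: "d > 0" "\<And>s. s \<in> {a..b} \<Longrightarrow> dist s t < d \<Longrightarrow> dist (F s) (F t) < F t"
    using F t pos unfolding continuous_on_iff by blast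
  \<comment> \<open>Half the radius keeps the closed interval within distance \<open>d\<close> of
    \<open>t\<close>. Clipping to \<open>{a..b}\<close> allows \<open>t\<close> to be an endpoint,
    and \<open>a < b\<close> still leaves \<open>c < e\<close>.\<close>
  define c e where "c = max a (t - d / 2)" and "e = min b (t + d / 2)"
  have ce: "a \<le> c" "c < e" "e \<le> b"
    using t d(1) ab by (auto simp: c_def e_def)
  have Fpos: "0 < F s" if "s \<in> {c..e}" for s
  proof -
    have "dist s t < d" "s \<in> {a..b}"
      using that d(1) by (auto simp: c_def e_def dist_real_def)
    then show ?thesis
      using d(2) [of s] by (auto simp: dist_real_def)
  qed
  \<comment> \<open>a \<open>C\<^sup>1\<close> bump supported on \<open>[c, e]\<close>\<close>
  define \<rho> where "\<rho> s = (max 0 ((s - c) * (e - s)))\<^sup>2" for s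
  define d\<rho> where "d\<rho> s = 2 * max 0 ((s - c) * (e - s)) * ((e - s) - (s - c))" for s
  have out: "(s - c) * (e - s) \<le> 0" if "s \<notin> {c..e}" for s
    using that ce by (auto simp: mult_le_0_iff)
  have \<rho>_F: "0 \<le> \<rho> s * F s" for s
  proof (cases "s \<in> {c..e}")
    case True
    then show ?thesis using Fpos [of s] by (simp add: \<rho>_def)
  next
    case False
    then show ?thesis using out [of s] by (simp add: \<rho>_def)
  qed
  have "(\<rho> has_real_derivative d\<rho> s) (at s within {a..b})" for s
  proof -
    have "((\<lambda>s. (s - c) * (e - s)) has_real_derivative (e - s) - (s - c)) (at s within {a..b})"
      by (auto intro!: derivative_eq_intros)
    from DERIV_chain2 [OF truncated_square_has_derivative this] show ?thesis
      by (simp add: \<rho>_def [abs_def] d\<rho>_def)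
  qed
  moreover have "continuous_on {a..b} d\<rho>"
    unfolding d\<rho>_def by (intro continuous_intros)
  \<comment> \<open>Since \<open>a \<le> c\<close> and \<open>e \<le> b\<close>, the product of the
    two linear factors is nonpositive at \<open>a\<close> and at \<open>b\<close>.\<close>
  moreover have "\<rho> a = 0" "\<rho> b = 0"
    using ce by (auto simp: \<rho>_def mult_nonpos_nonneg mult_nonneg_nonpos max_absorb1)
  ultimately have "integral {a..b} (\<lambda>s. \<rho> s * F s) = 0"
    by (intro zero) auto
  moreover have "continuous_on {a..b} (\<lambda>s. \<rho> s * F s)"
    unfolding \<rho>_def by (intro continuous_intros F)
  ultimately have "\<rho> s * F s = 0" if "s \<in> {a..b}" for s
    using integral_eq_0_iff [of a b "\<lambda>s. \<rho> s * F s"] ab \<rho>_F that by auto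
  moreover have "0 < ((c + e) / 2 - c) * (e - (c + e) / 2)"
    using ce by (intro mult_pos_pos) auto
  then have "0 < \<rho> ((c + e) / 2)"
    using ce by (simp add: \<rho>_def)
  moreover have "(c + e) / 2 \<in> {a..b}" "0 < F ((c + e) / 2)"
    using ce by (auto intro!: Fpos)
  ultimately show False
    by (metis mult_pos_pos less_irrefl)
qed

text \<open>The hypothesis is invariant under replacing \<open>F\<close> by \<open>- F\<close>, so
  the one-sided version applies to both.\<close>

lemma fundamental_lemma_of_variations:
  fixes F :: "real \<Rightarrow> real"
  assumes F: "continuous_on {a..b} F" and ab: "a < b"
    and zero: "\<And>\<rho> d\<rho>. \<lbrakk>\<And>t. t \<in> {a..b} \<Longrightarrow> (\<rho> has_real_derivative d\<rho> t) (at t within {a..b});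
      continuous_on {a..b} d\<rho>; \<rho> a = 0; \<rho> b = 0\<rbrakk> \<Longrightarrow> integral {a..b} (\<lambda>t. \<rho> t * F t) = 0"
    and t: "t \<in> {a..b}"
  shows "F t = 0"
proof (rule antisym)
  show "F t \<le> 0"
    by (rule fundamental_lemma_of_variations_nonpos [OF F ab zero t])
  have "- F t \<le> 0"
    by (rule fundamental_lemma_of_variations_nonpos [OF continuous_on_minus [OF F] ab _ t],
      simp only: mult_minus_right integral_neg neg_equal_0_iff_equal, rule zero)
  then show "0 \<le> F t" by simp
qed

section \<open>The Lagrange-d'Alembert principle\<close>

text \<open>A deformation stays in \<open>SE3\<close> for \<open>\<epsilon>\<close> near 0, so the
  two actions coincide there as functions of \<open>\<epsilon>\<close> and have the same derivatives
  at 0.\<close>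

lemma lagrange_dAlembert_cong:
  assumes "\<And>t q \<phi>. t \<in> {t0..T} \<Longrightarrow> q \<in> SE3 \<Longrightarrow> lag t q \<phi> = lag' t q \<phi>"
  shows "lagrange_dAlembert t0 T lag Dm h \<phi> \<longleftrightarrow> lagrange_dAlembert t0 T lag' Dm h \<phi>"
proof -
  have "((\<lambda>\<epsilon>. integral {t0..T} (\<lambda>t. lag t (H \<epsilon> t) (P \<epsilon> t))) has_real_derivative d) (at 0) \<longleftrightarrow>
      ((\<lambda>\<epsilon>. integral {t0..T} (\<lambda>t. lag' t (H \<epsilon> t) (P \<epsilon> t))) has_real_derivative d) (at 0)"
    if var: "realizes_variation t0 T h \<phi> \<eta> d\<eta> H P" for \<eta> d\<eta> H P d
  proof (rule DERIV_cong_ev)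
    obtain e dH dP where e: "e > 0"
      and "\<forall>\<epsilon>\<in>{-e<..<e}. \<forall>t\<in>{t0..T}. H \<epsilon> t \<in> SE3
        \<and> ((\<lambda>s. H s t) has_vector_derivative dH \<epsilon> t) (at \<epsilon>)
        \<and> ((\<lambda>s. P s t) has_vector_derivative dP \<epsilon> t) (at \<epsilon>)"
      using var unfolding realizes_variation_def by (elim exE conjE) (rule that)
    then have SE3: "H \<epsilon> t \<in> SE3" if "\<epsilon> \<in> {-e<..<e}" "t \<in> {t0..T}" for \<epsilon> t
      using that by blast
    have "\<forall>\<^sub>F \<epsilon> in nhds 0. \<epsilon> \<in> {-e<..<e}"
      using e by (intro eventually_nhds_in_open) auto
    then show "\<forall>\<^sub>F \<epsilon> in nhds 0. integral {t0..T} (\<lambda>t. lag t (H \<epsilon> t) (P \<epsilon> t)) =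
        integral {t0..T} (\<lambda>t. lag' t (H \<epsilon> t) (P \<epsilon> t))"
      by eventually_elim (intro integral_cong assms SE3)
  qed simp_all
  then show ?thesis
    unfolding lagrange_dAlembert_def by (intro all_cong1 imp_cong refl) (elim conjE)
qed

section \<open>The first variation of the action\<close>

text \<open>Differentiation under the integral sign over the parameter interval of the variation.
  The joint continuity of \<open>H\<close>, \<open>P\<close>, \<open>dH\<close> and
  \<open>dP\<close> yields that of the differentiated integrand, as the Leibniz rule
  requires.\<close>

lemma lab_lagrangian_action_has_derivative:
  assumes W: "transpose W = W" "pos_def W" and J: "transpose J = J"
    and \<Phi>: "\<And>s. s \<ge> 0 \<Longrightarrow> (\<Phi> has_real_derivative dPhi s) (at s within {0..})"
    and dPhi: "continuous_on {0..} dPhi"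
    and cont: "continuous_on {t0..T} M" "continuous_on {t0..T} D" "continuous_on {t0..T} c"
      "continuous_on {t0..T} p"
    and var: "realizes_variation t0 T h \<phi> \<eta> d\<eta> H P"
  shows "((\<lambda>\<epsilon>. integral {t0..T} (\<lambda>t. lab_lagrangian J \<Phi> \<kappa> W (M t) (D t) (c t) (p t) (H \<epsilon> t) (P \<epsilon> t)))
    has_real_derivative integral {t0..T} (\<lambda>t. lab_lagrangian_deriv J dPhi \<kappa> W (M t) (D t) (c t) (p t)
      (h t) (\<phi> t) (h t ** hat (\<eta> t)) (d\<eta> t + ad (\<phi> t) *v \<eta> t))) (at 0)"
proof -
  obtain e dH dP where e: "e > 0"
    and d: "\<forall>\<epsilon>\<in>{-e<..<e}. \<forall>t\<in>{t0..T}. H \<epsilon> t \<in> SE3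
      \<and> ((\<lambda>s. H s t) has_vector_derivative dH \<epsilon> t) (at \<epsilon>)
      \<and> ((\<lambda>s. P s t) has_vector_derivative dP \<epsilon> t) (at \<epsilon>)"
    and C: "continuous_on ({-e<..<e} \<times> {t0..T}) (\<lambda>x. H (fst x) (snd x))"
      "continuous_on ({-e<..<e} \<times> {t0..T}) (\<lambda>x. P (fst x) (snd x))"
      "continuous_on ({-e<..<e} \<times> {t0..T}) (\<lambda>x. dH (fst x) (snd x))"
      "continuous_on ({-e<..<e} \<times> {t0..T}) (\<lambda>x. dP (fst x) (snd x))"
    and 0: "\<forall>t\<in>{t0..T}. H 0 t = h t \<and> P 0 t = \<phi> t \<and> dH 0 t = h t ** hat (\<eta> t)
      \<and> dP 0 t = d\<eta> t + ad (\<phi> t) *v \<eta> t"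
    using var unfolding realizes_variation_def split_def by (elim exE conjE) (rule that)
  let ?U = "{-e<..<e}"
  let ?f = "\<lambda>\<epsilon> t. lab_lagrangian J \<Phi> \<kappa> W (M t) (D t) (c t) (p t) (H \<epsilon> t) (P \<epsilon> t)"
  let ?f' = "\<lambda>\<epsilon> t. lab_lagrangian_deriv J dPhi \<kappa> W (M t) (D t) (c t) (p t) (H \<epsilon> t) (P \<epsilon> t) (dH \<epsilon> t) (dP \<epsilon> t)"
  have snd: "continuous_on (?U \<times> {t0..T}) (\<lambda>x. f (snd x))"
    if "continuous_on {t0..T} f" for f :: "real \<Rightarrow> 'b::real_normed_vector"
    by (rule continuous_on_compose2 [OF that]) (auto intro!: continuous_intros)
  have slice: "continuous_on {t0..T} (\<lambda>t. G \<epsilon> t)"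
    if "continuous_on (?U \<times> {t0..T}) (\<lambda>x. G (fst x) (snd x))" "\<epsilon> \<in> ?U"
    for G :: "real \<Rightarrow> real \<Rightarrow> 'b::real_normed_vector" and \<epsilon>
  proof -
    have "continuous_on {t0..T} (\<lambda>t. (\<epsilon>, t))" "(\<lambda>t. (\<epsilon>, t)) ` {t0..T} \<subseteq> ?U \<times> {t0..T}"
      using that(2) by (auto intro!: continuous_intros)
    from continuous_on_compose2 [OF that(1) this] show ?thesis
      by simp
  qed
  have cont_\<Phi>: "continuous_on {0..} \<Phi>"
    using \<Phi> by (intro DERIV_continuous_on) auto
  have "((\<lambda>\<epsilon>. integral (cbox t0 T) (?f \<epsilon>)) has_real_derivative integral (cbox t0 T) (?f' 0)) (at 0 within ?U)"
  proof (rule leibniz_rule_field_derivative)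
    fix \<epsilon> t assume "\<epsilon> \<in> ?U" "t \<in> cbox t0 T"
    then have "\<epsilon> \<in> ?U" "t \<in> {t0..T}" by auto
    from bspec [OF bspec [OF d this(1)] this(2)]
    have "((\<lambda>s. H s t) has_vector_derivative dH \<epsilon> t) (at \<epsilon> within ?U)"
      "((\<lambda>s. P s t) has_vector_derivative dP \<epsilon> t) (at \<epsilon> within ?U)"
      by (blast intro: has_vector_derivative_at_within)+
    with lab_lagrangian_has_derivative [where q = "\<lambda>s. H s t" and \<phi> = "\<lambda>s. P s t", OF W J]
    show "((\<lambda>\<epsilon>. ?f \<epsilon> t) has_real_derivative ?f' \<epsilon> t) (at \<epsilon> within ?U)"
      using \<Phi> by blast
  next
    fix \<epsilon> assume "\<epsilon> \<in> ?U"
    then show "?f \<epsilon> integrable_on cbox t0 T"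
      unfolding cbox_interval
      by (intro integrable_continuous_interval continuous_on_lab_lagrangian W cont_\<Phi> cont slice C)
  next
    show "continuous_on (?U \<times> cbox t0 T) (\<lambda>(\<epsilon>, t). ?f' \<epsilon> t)"
      unfolding cbox_interval split_def
      by (intro continuous_on_lab_lagrangian_deriv W dPhi C snd cont)
  qed (use e in auto)
  moreover have "at 0 within ?U = at 0"
    using e by (intro at_within_open) auto
  moreover have "integral {t0..T} (?f' 0) = integral {t0..T} (\<lambda>t. lab_lagrangian_deriv J dPhi \<kappa> W
      (M t) (D t) (c t) (p t) (h t) (\<phi> t) (h t ** hat (\<eta> t)) (d\<eta> t + ad (\<phi> t) *v \<eta> t))"
    using 0 by (intro integral_cong) auto
  ultimately show ?thesis
    by simp
qed

text \<open>Integration by parts trades \<open>d\<eta> t \<bullet> (J *v \<phi> t)\<close> for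
  \<open>- (\<eta> t \<bullet> (J *v d\<phi> t))\<close>, while \<open>ad\<close> passes to the
  other side of the pairing as its transpose.\<close>

lemma lab_lagrangian_first_variation:
  assumes "t0 \<le> T" and W: "transpose W = W" "pos_def W" and J: "transpose J = J"
    and \<Phi>: "\<And>s. s \<ge> 0 \<Longrightarrow> (\<Phi> has_real_derivative dPhi s) (at s within {0..})"
    and dPhi: "continuous_on {0..} dPhi"
    and cont: "continuous_on {t0..T} (\<lambda>t. R t ** Lm t)" "continuous_on {t0..T} D"
      "continuous_on {t0..T} (\<lambda>t. R t *v am t + b t)" "continuous_on {t0..T} p"
    and R: "\<And>t. t \<in> {t0..T} \<Longrightarrow> rotation_matrix (R t)"
    and h: "\<And>t. t \<in> {t0..T} \<Longrightarrow> h t \<in> SE3"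
    and \<phi>: "\<And>t. t \<in> {t0..T} \<Longrightarrow> (\<phi> has_vector_derivative d\<phi> t) (at t within {t0..T})"
      "continuous_on {t0..T} d\<phi>"
    and Z: "continuous_on {t0..T} (\<lambda>t. Z dPhi \<kappa> W (matrix_inv (h t) ** pose (R t) (b t)) (Lm t) (D t) (am t) (p t))"
    and \<eta>: "\<And>t. t \<in> {t0..T} \<Longrightarrow> (\<eta> has_vector_derivative d\<eta> t) (at t within {t0..T})"
      "continuous_on {t0..T} d\<eta>" "\<eta> t0 = 0" "\<eta> T = 0"
    and var: "realizes_variation t0 T h \<phi> \<eta> d\<eta> H P"
  shows "((\<lambda>\<epsilon>. integral {t0..T} (\<lambda>t. lab_lagrangian J \<Phi> \<kappa> W (R t ** Lm t) (D t)
        (R t *v am t + b t) (p t) (H \<epsilon> t) (P \<epsilon> t)))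
    has_real_derivative integral {t0..T} (\<lambda>t. \<eta> t \<bullet> (ad_star (\<phi> t) *v (J *v \<phi> t) - J *v d\<phi> t
      - Z dPhi \<kappa> W (matrix_inv (h t) ** pose (R t) (b t)) (Lm t) (D t) (am t) (p t)))) (at 0)"
    (is "(_ has_real_derivative integral _ (\<lambda>t. _ \<bullet> (?A t - _ - ?Z t))) _")
proof -
  have c\<phi>: "continuous_on {t0..T} \<phi>"
    using \<phi>(1) by (rule continuous_on_vector_derivative)
  have c\<eta>: "continuous_on {t0..T} \<eta>"
    using \<eta>(1) by (rule continuous_on_vector_derivative)
  \<comment> \<open>The time derivative of \<open>\<eta> t \<bullet> (J *v \<phi> t)\<close>; its
    integral vanishes because \<open>\<eta>\<close> does at both ends.\<close>
  let ?B = "\<lambda>t. \<eta> t \<bullet> (J *v d\<phi> t) + d\<eta> t \<bullet> (J *v \<phi> t)"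
  have "(?B has_integral (\<eta> T \<bullet> (J *v \<phi> T) - \<eta> t0 \<bullet> (J *v \<phi> t0))) {t0..T}"
    using assms(1)
    by (intro fundamental_theorem_of_calculus bounded_bilinear.has_vector_derivative [OF bounded_bilinear_inner]
        \<eta> bounded_linear.has_vector_derivative [OF matvec.bounded_linear_right] \<phi>)
  then have B: "(?B has_integral 0) {t0..T}"
    using \<eta> by simp
  let ?G = "\<lambda>t. \<eta> t \<bullet> (?A t - J *v d\<phi> t - ?Z t)"
  have "?G integrable_on {t0..T}"
    unfolding ad_star_def
    by (intro integrable_continuous_interval continuous_intros c\<eta> c\<phi> \<phi> Z bounded_linear.continuous_on [OF bounded_linear_ad])
  with B have "((\<lambda>t. ?G t + ?B t) has_integral integral {t0..T} ?G + 0) {t0..T}"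
    by (intro has_integral_add integrable_integral)
  moreover have "?G t + ?B t = lab_lagrangian_deriv J dPhi \<kappa> W (R t ** Lm t) (D t)
        (R t *v am t + b t) (p t) (h t) (\<phi> t) (h t ** hat (\<eta> t)) (d\<eta> t + ad (\<phi> t) *v \<eta> t)"
    if "t \<in> {t0..T}" for t
  proof -
    have "(ad (\<phi> t) *v \<eta> t) \<bullet> (J *v \<phi> t) = \<eta> t \<bullet> (ad_star (\<phi> t) *v (J *v \<phi> t))"
      by (simp add: ad_star_def inner_mult_vec inner_commute [of "\<eta> t"] del: transpose_matrix_vector)
    then show ?thesis
      using that by (simp add: lab_lagrangian_deriv_reduced_variation W h R inner_add_left inner_diff_right)
  qed
  ultimately have eq: "integral {t0..T} (\<lambda>t. lab_lagrangian_deriv J dPhi \<kappa> W (R t ** Lm t) (D t)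
        (R t *v am t + b t) (p t) (h t) (\<phi> t) (h t ** hat (\<eta> t)) (d\<eta> t + ad (\<phi> t) *v \<eta> t)) =
      integral {t0..T} ?G"
    by (metis (no_types, lifting) add.right_neutral integral_cong integral_unique)
  show ?thesis
    using lab_lagrangian_action_has_derivative [OF W J \<Phi> dPhi cont var, where \<kappa> = \<kappa>]
    by (simp only: eq)
qed

text \<open>The equation of motion makes the two integrands equal pointwise. Conversely, comparing
  the two expressions for the derivative of the action along
  \<open>\<rho> t *\<^sub>R \<zeta>\<close> shows that the defect of the equation, paired with
  \<open>\<zeta>\<close>, integrates to zero against every admissible \<open>\<rho>\<close>.\<close>

lemma lab_lagrangian_lagrange_dAlembert_iff:
  assumes "t0 < T" and W: "transpose W = W" "pos_def W" and J: "transpose J = J"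
    and \<Phi>: "\<And>s. s \<ge> 0 \<Longrightarrow> (\<Phi> has_real_derivative dPhi s) (at s within {0..})"
    and dPhi: "continuous_on {0..} dPhi"
    and cont: "continuous_on {t0..T} R" "continuous_on {t0..T} b" "continuous_on {t0..T} D"
      "continuous_on {t0..T} Lm" "continuous_on {t0..T} am" "continuous_on {t0..T} p"
    and R: "\<And>t. t \<in> {t0..T} \<Longrightarrow> rotation_matrix (R t)"
    and h: "\<And>t. t \<in> {t0..T} \<Longrightarrow> h t \<in> SE3" "continuous_on {t0..T} h"
    and \<phi>: "\<And>t. t \<in> {t0..T} \<Longrightarrow> (\<phi> has_vector_derivative d\<phi> t) (at t within {t0..T})"
      "continuous_on {t0..T} d\<phi>"
    and gh: "\<And>t. t \<in> {t0..T} \<Longrightarrow> gh t = matrix_inv (h t) ** pose (R t) (b t)"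
      "continuous_on {t0..T} gh"
  shows "lagrange_dAlembert t0 T (\<lambda>t q. lab_lagrangian J \<Phi> \<kappa> W (R t ** Lm t) (D t)
      (R t *v am t + b t) (p t) q) Dm h \<phi> \<longleftrightarrow>
    (\<forall>t\<in>{t0..T}. J *v d\<phi> t = ad_star (\<phi> t) *v (J *v \<phi> t)
      - Z dPhi \<kappa> W (gh t) (Lm t) (D t) (am t) (p t) - Dm *v \<phi> t)"
    (is "?lhs \<longleftrightarrow> ?rhs")
proof -
  let ?Z = "\<lambda>t. Z dPhi \<kappa> W (gh t) (Lm t) (D t) (am t) (p t)"
  let ?G = "\<lambda>t. ad_star (\<phi> t) *v (J *v \<phi> t) - J *v d\<phi> t - ?Z t"
  let ?S = "\<lambda>H P \<epsilon>. integral {t0..T} (\<lambda>t. lab_lagrangian J \<Phi> \<kappa> W (R t ** Lm t) (D t)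
      (R t *v am t + b t) (p t) (H \<epsilon> t) (P \<epsilon> t))"
  have c\<phi>: "continuous_on {t0..T} \<phi>"
    using \<phi>(1) by (rule continuous_on_vector_derivative)
  have stack: "bounded_linear (\<lambda>x. stack (fst x) (snd x) :: twist)"
    by (auto simp: linear_conv_bounded_linear [symmetric] linear_iff stack_def vec_eq_iff all_UNIV_plus)
  note cross = bounded_linear.continuous_on [OF bounded_linear_cross_mat]
  have cS: "continuous_on {t0..T} (\<lambda>t. stack (u t) (v t) :: twist)"
    if "continuous_on {t0..T} u" "continuous_on {t0..T} v" for u v
    using bounded_linear.continuous_on [OF stack continuous_on_Pair [OF that]] by simp
  have cy: "continuous_on {t0..T} (\<lambda>t. pos_err (gh t) (am t) (p t))"
    unfolding pos_err_def by (intro continuous_intros gh cont)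
  have U: "U0r W g L D = weighted_square W (D - rot g ** L)" for g L D
    by (simp add: U0r_def weighted_square_def mat_inner_eq_inner)
  have cZ: "continuous_on {t0..T} ?Z"
    unfolding Z_def Let_def U S_Gamma_eq
    by (intro cS continuous_on_add continuous_on_scaleR continuous_on_const cy matvec.continuous_on cross
        cont continuous_on_nonneg_compose_weighted_square W dPhi continuous_on_diff matmul.continuous_on
        bounded_linear.continuous_on [OF bounded_linear_skew_vec]
        bounded_linear.continuous_on [OF bounded_linear_rot]
        bounded_linear.continuous_on [OF bounded_linear_transpose] gh)
  have cG: "continuous_on {t0..T} ?G"
    unfolding ad_star_def
    by (intro continuous_intros c\<phi> \<phi> cZ bounded_linear.continuous_on [OF bounded_linear_ad])
  have first_variation: "(?S H P has_real_derivative integral {t0..T} (\<lambda>t. \<eta> t \<bullet> ?G t)) (at 0)"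
    if \<eta>: "\<And>t. t \<in> {t0..T} \<Longrightarrow> (\<eta> has_vector_derivative d\<eta> t) (at t within {t0..T})"
      "continuous_on {t0..T} d\<eta>" "\<eta> t0 = 0" "\<eta> T = 0"
      and var: "realizes_variation t0 T h \<phi> \<eta> d\<eta> H P" for \<eta> d\<eta> H P
  proof -
    have "continuous_on {t0..T} (\<lambda>t. Z dPhi \<kappa> W (matrix_inv (h t) ** pose (R t) (b t)) (Lm t) (D t) (am t) (p t))"
      using cZ by (rule continuous_on_eq) (simp add: gh)
    then have "(?S H P has_real_derivative integral {t0..T} (\<lambda>t. \<eta> t \<bullet> (ad_star (\<phi> t) *v (J *v \<phi> t)
      - J *v d\<phi> t - Z dPhi \<kappa> W (matrix_inv (h t) ** pose (R t) (b t)) (Lm t) (D t) (am t) (p t)))) (at 0)"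
      using assms(1)
      by (intro lab_lagrangian_first_variation [where d\<eta> = d\<eta>] W J \<Phi> dPhi R h \<phi> \<eta> var continuous_intros cont) auto
    moreover have "integral {t0..T} (\<lambda>t. \<eta> t \<bullet> (ad_star (\<phi> t) *v (J *v \<phi> t)
      - J *v d\<phi> t - Z dPhi \<kappa> W (matrix_inv (h t) ** pose (R t) (b t)) (Lm t) (D t) (am t) (p t))) =
      integral {t0..T} (\<lambda>t. \<eta> t \<bullet> ?G t)"
      by (intro integral_cong) (simp add: gh)
    ultimately show ?thesis by simp
  qed
  show ?thesis
  proof
    assume rhs: ?rhs
    show ?lhs
      unfolding lagrange_dAlembert_def
    proof (intro allI impI, elim conjE)
      fix \<eta> d\<eta> H P
      assume "\<forall>t\<in>{t0..T}. (\<eta> has_vector_derivative d\<eta> t) (at t within {t0..T})"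
        "continuous_on {t0..T} d\<eta>" "\<eta> t0 = 0" "\<eta> T = 0" "realizes_variation t0 T h \<phi> \<eta> d\<eta> H P"
      then have "(?S H P has_real_derivative integral {t0..T} (\<lambda>t. \<eta> t \<bullet> ?G t)) (at 0)"
        by (intro first_variation) auto
      moreover have "integral {t0..T} (\<lambda>t. \<eta> t \<bullet> ?G t) = integral {t0..T} (\<lambda>t. \<eta> t \<bullet> (Dm *v \<phi> t))"
        using rhs by (intro integral_cong) simp
      ultimately show "(?S H P has_real_derivative integral {t0..T} (\<lambda>t. \<eta> t \<bullet> (Dm *v \<phi> t))) (at 0)"
        by simp
    qed
  next
    assume lhs: ?lhs
    \<comment> \<open>The defect of the equation of motion.\<close>
    define F where "F t = ?G t - Dm *v \<phi> t" for t
    have cF: "continuous_on {t0..T} F"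
      unfolding F_def by (intro continuous_on_diff cG matvec.continuous_on continuous_on_const c\<phi>)
    have zero: "\<zeta> \<bullet> F t = 0" if \<zeta>: "ang \<zeta> = 0 \<or> norm (ang \<zeta>) = 1" and t: "t \<in> {t0..T}" for \<zeta> t
    proof (rule fundamental_lemma_of_variations [OF _ assms(1) _ t])
      show "continuous_on {t0..T} (\<lambda>t. \<zeta> \<bullet> F t)"
        by (intro continuous_intros cF)
    next
      fix \<rho> d\<rho> :: "real \<Rightarrow> real"
      assume \<rho>: "\<And>t. t \<in> {t0..T} \<Longrightarrow> (\<rho> has_real_derivative d\<rho> t) (at t within {t0..T})"
        "continuous_on {t0..T} d\<rho>" "\<rho> t0 = 0" "\<rho> T = 0"
      have c\<rho>: "continuous_on {t0..T} \<rho>"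
        using \<rho>(1) by (rule DERIV_continuous_on)
      let ?\<eta> = "\<lambda>t. \<rho> t *\<^sub>R \<zeta>"
      let ?d\<eta> = "\<lambda>t. d\<rho> t *\<^sub>R \<zeta>"
      obtain H P where var: "realizes_variation t0 T h \<phi> ?\<eta> ?d\<eta> H P"
        using realizes_variation_direction [OF h c\<phi> c\<rho> \<rho>(2) \<zeta>] by blast
      have \<eta>: "\<And>t. t \<in> {t0..T} \<Longrightarrow> (?\<eta> has_vector_derivative ?d\<eta> t) (at t within {t0..T})"
        "continuous_on {t0..T} ?d\<eta>" "?\<eta> t0 = 0" "?\<eta> T = 0"
        using \<rho> by (auto intro!: derivative_eq_intros continuous_intros)
      have "(?S H P has_real_derivative integral {t0..T} (\<lambda>t. ?\<eta> t \<bullet> (Dm *v \<phi> t))) (at 0)"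
        by (rule lhs [unfolded lagrange_dAlembert_def, THEN spec, THEN spec [of _ ?d\<eta>],
              THEN spec, THEN spec, THEN mp])
          (use \<eta> var in blast)
      \<comment> \<open>The principle and the first variation give two derivatives of the same
        action at 0.\<close>
      with first_variation [OF \<eta> var]
      have "integral {t0..T} (\<lambda>t. ?\<eta> t \<bullet> ?G t) = integral {t0..T} (\<lambda>t. ?\<eta> t \<bullet> (Dm *v \<phi> t))"
        by (rule DERIV_unique)
      moreover have "integral {t0..T} (\<lambda>t. ?\<eta> t \<bullet> ?G t - ?\<eta> t \<bullet> (Dm *v \<phi> t)) =
          integral {t0..T} (\<lambda>t. ?\<eta> t \<bullet> ?G t) - integral {t0..T} (\<lambda>t. ?\<eta> t \<bullet> (Dm *v \<phi> t))"
        by (intro Henstock_Kurzweil_Integration.integral_diff integrable_continuous_interval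
            continuous_on_inner continuous_on_scaleR continuous_on_const c\<rho> cG matvec.continuous_on c\<phi>)
      moreover have "\<rho> t * (\<zeta> \<bullet> F t) = ?\<eta> t \<bullet> ?G t - ?\<eta> t \<bullet> (Dm *v \<phi> t)" for t
        by (simp add: F_def inner_diff_right right_diff_distrib)
      ultimately show "integral {t0..T} (\<lambda>t. \<rho> t * (\<zeta> \<bullet> F t)) = 0"
        by simp
    qed
    have "F t = 0" if t: "t \<in> {t0..T}" for t
    proof -
      \<comment> \<open>An angular basis vector has a unit angular part and a linear one has none,
        so both are admissible, and pairing with them reads off the components.\<close>
      have "F t $ Inl k = 0" "F t $ Inr k = 0" for k
      proof -
        have "ang (axis (Inl k) 1) = axis k 1" "ang (axis (Inr k) 1) = 0"
          by (simp_all add: ang_def axis_def vec_eq_iff)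
        then show "F t $ Inl k = 0" "F t $ Inr k = 0"
          using zero [of "axis (Inl k) 1" t] zero [of "axis (Inr k) 1" t] t
          by (simp_all add: inner_axis')
      qed
      then show ?thesis
        by (simp add: vec_eq_iff all_UNIV_plus)
    qed
    then show ?rhs
      by (auto simp: F_def algebra_simps)
  qed
qed

text \<open>The first equivalence is the noise-free principle, expressed through the measurements.
  The second applies the principle to the measured Lagrangian, noise allowed, read as a function of
  the relative pose \<open>q\<close> through the estimate
  \<open>matrix_inv q ** g t\<close>.\<close>

theorem theorem8p1:
  fixes t0 T \<kappa> :: real
    and J Dm :: "real^(3 + 3)^(3 + 3)"
    and \<Phi> dPhi ddPhi :: "real \<Rightarrow> real"
    and W :: "real^'n^'n"
    and D Lm :: "real \<Rightarrow> real^'n^3"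
    and p am b bh :: "real \<Rightarrow> real^3"
    and R Rh :: "real \<Rightarrow> real^3^3"
    and g gh h :: "real \<Rightarrow> hmat"
    and \<xi> \<xi>m \<xi>h \<phi> d\<phi> :: "real \<Rightarrow> twist"
  assumes "t0 < T"
    and "\<kappa> > 0"
    and "transpose J = J" and "pos_def J" and "pos_def Dm"
    and "transpose W = W" and "pos_def W"
    and "\<And>s. s \<ge> 0 \<Longrightarrow> \<Phi> s \<ge> 0"
    and "\<And>s. s \<ge> 0 \<Longrightarrow> (\<Phi> has_real_derivative dPhi s) (at s within {0..})"
    and "\<And>s. s \<ge> 0 \<Longrightarrow> (dPhi has_real_derivative ddPhi s) (at s within {0..})"
    and "continuous_on {0..} ddPhi"
    and "\<Phi> 0 = 0"
    and "\<And>s. s \<ge> 0 \<Longrightarrow> dPhi s > 0"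
    and "\<And>t. t \<in> {t0..T} \<Longrightarrow> rank (D t) = 3"
    and "continuous_on {t0..T} D" and "continuous_on {t0..T} p"
    and "continuous_on {t0..T} Lm" and "continuous_on {t0..T} am"
    and "\<And>t. t \<in> {t0..T} \<Longrightarrow> rotation_matrix (R t)"
    and "\<And>t. t \<in> {t0..T} \<Longrightarrow> g t = pose (R t) (b t)"
    and "\<And>t. t \<in> {t0..T} \<Longrightarrow> (g has_vector_derivative g t ** hat (\<xi> t)) (at t within {t0..T})"
    and "\<And>t. t \<in> {t0..T} \<Longrightarrow> rotation_matrix (Rh t)"
    and "\<And>t. t \<in> {t0..T} \<Longrightarrow> gh t = pose (Rh t) (bh t)"
    and "\<And>t. t \<in> {t0..T} \<Longrightarrow> (gh has_vector_derivative gh t ** hat (\<xi>h t)) (at t within {t0..T})"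
    and "\<And>t. t \<in> {t0..T} \<Longrightarrow> h t = g t ** matrix_inv (gh t)"
    and "\<And>t. t \<in> {t0..T} \<Longrightarrow> \<phi> t = Ad (gh t) *v (\<xi>m t - \<xi>h t)"
    and "\<And>t. t \<in> {t0..T} \<Longrightarrow> (\<phi> has_vector_derivative d\<phi> t) (at t within {t0..T})"
    and "continuous_on {t0..T} d\<phi>"
  shows
    "((\<forall>t\<in>{t0..T}. Lm t = transpose (R t) ** D t \<and> am t = transpose (R t) *v (p t - b t) \<and> \<xi>m t = \<xi> t)
        \<longrightarrow> (lagrange_dAlembert t0 T (\<lambda>t q. reduced_lagrangian J \<Phi> \<kappa> W q (D t) (p t)) Dm h \<phi>
               \<longleftrightarrow> variational_estimator t0 T J Dm dPhi \<kappa> W D p \<xi>m Lm am gh \<xi>h \<phi> d\<phi>))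
     \<and> (lagrange_dAlembert t0 T
            (\<lambda>t q. measured_lagrangian J \<Phi> \<kappa> W (matrix_inv q ** g t) (Lm t) (D t) (am t) (p t)) Dm h \<phi>
          \<longleftrightarrow> variational_estimator t0 T J Dm dPhi \<kappa> W D p \<xi>m Lm am gh \<xi>h \<phi> d\<phi>)"
proof -
  have R: "rotation_matrix (R t)" and Rh: "rotation_matrix (Rh t)" and g: "g t = pose (R t) (b t)"
    and gh: "gh t = pose (Rh t) (bh t)" and h: "h t = g t ** matrix_inv (gh t)"
    if "t \<in> {t0..T}" for t
    using assms that by auto
  have cg: "continuous_on {t0..T} g"
    using assms(21) by (rule continuous_on_vector_derivative)
  have cgh: "continuous_on {t0..T} gh"
    using assms(24) by (rule continuous_on_vector_derivative)
  have cR: "continuous_on {t0..T} R"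
    by (rule continuous_on_eq [OF bounded_linear.continuous_on [OF bounded_linear_rot cg]]) (simp add: g)
  have cb: "continuous_on {t0..T} b"
    by (rule continuous_on_eq [OF bounded_linear.continuous_on [OF bounded_linear_trans_part cg]]) (simp add: g)
  have cRh: "continuous_on {t0..T} Rh"
    by (rule continuous_on_eq [OF bounded_linear.continuous_on [OF bounded_linear_rot cgh]]) (simp add: gh)
  have cbh: "continuous_on {t0..T} bh"
    by (rule continuous_on_eq [OF bounded_linear.continuous_on [OF bounded_linear_trans_part cgh]]) (simp add: gh)
  have h_pose: "h t = pose (R t ** transpose (Rh t)) (b t - (R t ** transpose (Rh t)) *v bh t)"
    if "t \<in> {t0..T}" for t
    using that by (simp add: h g gh matrix_inv_pose Rh pose_mult matvec.minus_right
        matrix_vector_mul_assoc del: transpose_matrix_vector)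
  have rot: "rotation_matrix (R t ** transpose (Rh t))" if "t \<in> {t0..T}" for t
    using that by (intro rotation_matrix_mult rotation_matrix_transpose R Rh)
  have h_SE3: "h t \<in> SE3" if "t \<in> {t0..T}" for t
    using that by (simp add: h_pose SE3_pose rot)
  \<comment> \<open>The explicit pose form of \<open>h\<close> reduces its continuity to that of
    rotations and translations and avoids \<open>matrix_inv\<close>.\<close>
  have ch: "continuous_on {t0..T} h"
  proof (rule continuous_on_eq)
    show "continuous_on {t0..T} (\<lambda>t. tangent (R t ** transpose (Rh t))
        (b t - (R t ** transpose (Rh t)) *v bh t) + block 0 0 0 (mat 1))"
      by (intro continuous_intros cR cRh cb cbh)
  qed (simp add: h_pose pose_eq_tangent)
  have inv_h: "gh t = matrix_inv (h t) ** pose (R t) (b t)" if t: "t \<in> {t0..T}" for t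
  proof -
    note r = rotation_matrix_inverse [OF R [OF t]]
    have "Rh t ** transpose (R t) ** R t = Rh t"
      by (simp add: matrix_mul_assoc [symmetric] r)
    moreover have "Rh t ** transpose (R t) ** (R t ** transpose (Rh t)) = mat 1"
      using rotation_matrix_inverse(2) [OF rot [OF t]] by (simp add: matrix_transpose_mul)
    ultimately show ?thesis
      using t by (simp add: h_pose matrix_inv_pose rot pose_mult gh matrix_transpose_mul
          matvec.diff_right matrix_vector_mul_assoc del: transpose_matrix_vector)
  qed
  \<comment> \<open>The definition of \<open>\<phi>\<close> solved for \<open>\<xi>h\<close>. With
    the assumed kinematics of \<open>gh\<close>, only the first equation of the estimator remains to
    be matched with the principle.\<close>
  have \<xi>h: "\<xi>h t = \<xi>m t - Ad (matrix_inv (gh t)) *v \<phi> t" if "t \<in> {t0..T}" for t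
    using that by (simp add: assms(26) gh matrix_vector_mul_assoc Ad_matrix_inv_pose Rh)
  have dPhi: "continuous_on {0..} dPhi"
    by (rule DERIV_continuous_on) (use assms(10) in auto)
  let ?lab = "\<lambda>t. lab_lagrangian J \<Phi> \<kappa> W (R t ** Lm t) (D t) (R t *v am t + b t) (p t)"
  have "lagrange_dAlembert t0 T ?lab Dm h \<phi> \<longleftrightarrow> (\<forall>t\<in>{t0..T}. J *v d\<phi> t = ad_star (\<phi> t) *v (J *v \<phi> t)
      - Z dPhi \<kappa> W (gh t) (Lm t) (D t) (am t) (p t) - Dm *v \<phi> t)"
    by (rule lab_lagrangian_lagrange_dAlembert_iff [OF assms(1,6,7,3,9) dPhi cR cb assms(15,17,18,16)
          R h_SE3 ch assms(27,28) inv_h cgh])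
  then have iff: "lagrange_dAlembert t0 T ?lab Dm h \<phi> \<longleftrightarrow>
      variational_estimator t0 T J Dm dPhi \<kappa> W D p \<xi>m Lm am gh \<xi>h \<phi> d\<phi>"
    unfolding variational_estimator_def using \<xi>h assms(24) by auto
  have measured: "lagrange_dAlembert t0 T
      (\<lambda>t q. measured_lagrangian J \<Phi> \<kappa> W (matrix_inv q ** g t) (Lm t) (D t) (am t) (p t)) Dm h \<phi> \<longleftrightarrow>
      lagrange_dAlembert t0 T ?lab Dm h \<phi>"
    by (rule lagrange_dAlembert_cong) (simp add: g R measured_lagrangian_inverse)
  have reduced: "lagrange_dAlembert t0 T (\<lambda>t q. reduced_lagrangian J \<Phi> \<kappa> W q (D t) (p t)) Dm h \<phi> \<longleftrightarrow>
      lagrange_dAlembert t0 T ?lab Dm h \<phi>"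
    if "\<forall>t\<in>{t0..T}. Lm t = transpose (R t) ** D t \<and> am t = transpose (R t) *v (p t - b t) \<and> \<xi>m t = \<xi> t"
  proof (rule lagrange_dAlembert_cong)
    fix t q \<psi> assume t: "t \<in> {t0..T}" and q: "q \<in> SE3"
    \<comment> \<open>Carried back to the inertial frame, noise-free measurements no longer involve
      the true pose.\<close>
    have "R t ** Lm t = D t" "R t *v am t + b t = p t"
      using that t rotation_matrix_inverse [OF R [OF t]]
      by (simp_all add: matrix_mul_assoc matrix_vector_mul_assoc del: transpose_matrix_vector)
    then show "reduced_lagrangian J \<Phi> \<kappa> W q (D t) (p t) \<psi> = ?lab t q \<psi>"
      by (simp add: reduced_lagrangian_eq q assms(6))
  qed
  show ?thesis
    using measured reduced iff by blast
qed

end
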